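(* Fix a subcarrier $n$, let $\mathcal{U}_n=\{k:\rho_{k,n}=1\}$ be the set of scheduled users, $L_n=|\mathcal{U}_n|$, and assume $M_t>L_n$. Consider the downlink model of the context with zero-forcing (ZF) precoding, i.e. the vectors $\mathbf{t}_{\mathrm{c},i}[n]$, $i\in\mathcal{U}_n$, are the columns of $$\sqrt{M_t-L_n}\;\bar{\mathbf{G}}_n\big(\bar{\mathbf{G}}_n^H\bar{\mathbf{G}}_n\big)^{-1}\operatorname{diag}\{\sqrt{\alpha_{i,n}}:i\in\mathcal{U}_n\},\qquad \bar{\mathbf{G}}_n=[\bar{\mathbf{g}}_i[n]]_{i\in\mathcal{U}_n}\in\mathbb{C}^{M_t\times L_n}.$$ Then for every user $k\in\{1,\dots,K\}$ the use-and-then-forget (UatF) effective SINR of user $k$ on subcarrier $n$ equals $$\mathrm{SINR}^{\mathrm{eff,ZF}}_{k,n}=\frac{(M_t-L_n)\,\eta_k\,\rho_{k,n}\alpha_{k,n}}{\varepsilon_k\sum_{i=1}^{K}\rho_{i,n}\alpha_{i,n}+\xi_k\,\rho_n^{\mathrm{sen}}q_n+\sigma_{k,n}^2}.$$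
   Context: A base station with $M_t\ge 1$ antennas serves $K\ge 1$ single-antenna users. On subcarrier $n$: $\rho_{k,n}\in\{0,1\}$ indicates whether user $k$ is scheduled, $\rho_n^{\mathrm{sen}}\in\{0,1\}$ indicates whether sensing is active, $\alpha_{k,n}\ge 0$ is the communication power of user $k$, $q_n\ge 0$ is the sensing power, and $\mathbf{w}\in\mathbb{C}^{M_t}$ is a deterministic sensing beamformer with $\|\mathbf{w}\|_2=1$. Channels: the channel of user $k$ is $\mathbf{g}_k[n]=\widehat{\mathbf{g}}_k[n]+\mathbf{e}_k[n]\in\mathbb{C}^{M_t}$, where $\widehat{\mathbf{g}}_k[n]=\sqrt{\eta_k}\,\bar{\mathbf{g}}_k[n]$, $\bar{\mathbf{g}}_k[n]\sim\mathcal{CN}(\mathbf{0},\mathbf{I}_{M_t})$, $\mathbf{e}_k[n]\sim\mathcal{CN}(\mathbf{0},\varepsilon_k\mathbf{I}_{M_t})$, with $\eta_k>0$, $\varepsilon_k\ge 0$ and $\xi_k=\eta_k+\varepsilon_k$. All the vectors $\bar{\mathbf{g}}_1[n],\dots,\bar{\mathbf{g}}_K[n],\mathbf{e}_1[n],\dots,\mathbf{e}_K[n]$ are mutually independent. Here $\mathcal{CN}$ denotes the circularly symmetric complex Gaussian distribution. Signal: the transmitted vector is $\mathbf{x}=\sum_{i=1}^K \rho_{i,n}\mathbf{t}_{\mathrm{c},i}[n]s_i+\sqrt{q_n\rho_n^{\mathrm{sen}}}\,\mathbf{w}\,s^{\mathrm{sen}}$ with unit-power data symbols $s_i$ and sensing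 symbol $s^{\mathrm{sen}}$ (unscheduled users $i\notin\mathcal{U}_n$ have $\rho_{i,n}=0$, so their precoding vectors play no role and may be taken to be zero), and user $k$ receives $\mathbf{g}_k^H[n]\mathbf{x}+v_k$ with noise $v_k\sim\mathcal{CN}(0,\sigma_{k,n}^2)$, $\sigma_{k,n}^2>0$. UatF effective SINR: with $A_k=\rho_{k,n}\mathbf{g}_k^H[n]\mathbf{t}_{\mathrm{c},k}[n]$, $B_{k,i}=\rho_{i,n}\mathbf{g}_k^H[n]\mathbf{t}_{\mathrm{c},i}[n]$ for $i\ne k$, and $C_k=\sqrt{q_n\rho_n^{\mathrm{sen}}}\,\mathbf{g}_k^H[n]\mathbf{w}$, it is defined as $$\mathrm{SINR}^{\mathrm{eff}}_{k,n}=\frac{|\mathbb{E}[A_k]|^2}{\mathbb{E}[|A_k|^2]-|\mathbb{E}[A_k]|^2+\sum_{i\ne k}\mathbb{E}[|B_{k,i}|^2]+\mathbb{E}[|C_k|^2]+\sigma_{k,n}^2},$$ with expectations over the random channels (channel estimates and errors). *)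

theory Defs
  imports "HOL-Probability.Probability"
begin

(* CN(0, c I) for c \<ge> 0, i.e. E[z z^H] = c I.  The density is that of CN(0, I) with respect to
   Lebesgue measure on C^M = R^(2M); for c = 0 the result is the point mass at 0. *)
definition complex_gaussian :: "real \<Rightarrow> (complex ^ 'm::finite) measure" where
  "complex_gaussian c =
     distr (density lborel (\<lambda>z. ennreal (exp (- (norm z)\<^sup>2) / pi ^ CARD('m)))) borel
       (\<lambda>z. sqrt c *\<^sub>R z)"

lemma prob_space_complex_gaussian:
  "prob_space (complex_gaussian c :: (complex ^ 'm::finite) measure)"
proof -
  have dens: "normal_density 0 (1 / sqrt 2) x = exp (- x\<^sup>2) / sqrt pi" for x
    by (simp add: normal_density_def power_divide)
  have int1: "(\<integral>\<^sup>+x. ennreal (exp (- x\<^sup>2) / sqrt pi) \<partial>lborel) = 1"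
  proof -
    interpret prob_space "density lborel (normal_density 0 (1 / sqrt 2))"
      by (rule prob_space_normal_density) simp
    show ?thesis using emeasure_space_1 by (simp add: emeasure_density dens)
  qed
  have split: "exp (- (norm z)\<^sup>2) / pi ^ CARD('m) = (\<Prod>b\<in>Basis. exp (- (z \<bullet> b)\<^sup>2) / sqrt pi)"
    for z :: "complex ^ 'm"
  proof -
    have "(norm z)\<^sup>2 = (\<Sum>b\<in>Basis. (z \<bullet> b)\<^sup>2)"
      unfolding power2_norm_eq_inner by (subst euclidean_inner) (simp add: power2_eq_square)
    moreover have "sqrt pi ^ DIM(complex ^ 'm) = pi ^ CARD('m)"
      by (simp add: power_mult power_mult_distrib mult.commute[of _ 2])
    ultimately show ?thesis
      by (simp add: prod_dividef exp_sum sum_negf[symmetric] del: DIM_cart)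
  qed
  have "(\<integral>\<^sup>+z. ennreal (exp (- (norm z)\<^sup>2) / pi ^ CARD('m)) \<partial>(lborel :: (complex ^ 'm) measure))
      = (\<integral>\<^sup>+z. (\<Prod>b\<in>Basis. ennreal (exp (- (z \<bullet> b)\<^sup>2) / sqrt pi))
            \<partial>(lborel :: (complex ^ 'm) measure))"
    unfolding split by (simp add: prod_ennreal)
  also have "\<dots> = 1"
    by (subst nn_integral_lborel_prod) (simp_all add: int1)
  finally have "prob_space (density lborel
      (\<lambda>z :: complex ^ 'm. ennreal (exp (- (norm z)\<^sup>2) / pi ^ CARD('m))))"
    by (intro prob_spaceI) (simp add: emeasure_density)
  then show ?thesis
    unfolding complex_gaussian_def by (rule prob_space.prob_space_distr) simp
qed

(* g^H x *)
definition hinner :: "complex ^ 'm::finite \<Rightarrow> complex ^ 'm \<Rightarrow> complex" where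
  "hinner g x = (\<Sum>a\<in>UNIV. cnj (g $ a) * x $ a)"

definition hermitian_transpose :: "complex ^ 'n ^ 'm \<Rightarrow> complex ^ 'm ^ 'n" where
  "hermitian_transpose A = (\<chi> i j. cnj (A $ j $ i))"

(* Matrices whose rows or columns are indexed by a subset U of the users are represented
   by matrices over the whole user type that vanish outside U.  Under this representation sums,
   products and Hermitian transposes are the usual ones, id_on U is the U x U identity matrix and
   inv_on U A is the inverse of the U x U matrix A (arbitrary if A is singular, like matrix_inv). *)
definition id_on :: "'k set \<Rightarrow> complex ^ 'k ^ 'k" where
  "id_on U = (\<chi> i j. if i = j \<and> i \<in> U then 1 else 0)"

definition inv_on :: "'k::finite set \<Rightarrow> complex ^ 'k ^ 'k \<Rightarrow> complex ^ 'k ^ 'k" where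
  "inv_on U A = (SOME B. (\<forall>i j. i \<notin> U \<or> j \<notin> U \<longrightarrow> B $ i $ j = 0)
                       \<and> A ** B = id_on U \<and> B ** A = id_on U)"

lemma inv_on_UNIV: "inv_on UNIV A = matrix_inv A"
proof -
  have "id_on UNIV = (mat 1 :: complex ^ 'a ^ 'a)"
    by (simp add: id_on_def mat_def)
  then show ?thesis by (simp add: inv_on_def matrix_inv_def)
qed

lemma id_on_right_neutral:
  assumes "\<And>i j. j \<notin> U \<Longrightarrow> B $ i $ j = 0"
  shows "B ** id_on U = B"
proof -
  have "(\<Sum>l\<in>UNIV. B $ i $ l * (if l = j \<and> l \<in> U then 1 else 0)) = B $ i $ j" for i j
  proof -
    have "(\<Sum>l\<in>UNIV. B $ i $ l * (if l = j \<and> l \<in> U then 1 else 0))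
        = (\<Sum>l\<in>UNIV. if l = j then B $ i $ j else 0)"
      by (rule sum.cong) (auto simp: assms)
    then show ?thesis by simp
  qed
  then show ?thesis by (simp add: matrix_matrix_mult_def id_on_def vec_eq_iff)
qed

lemma id_on_left_neutral:
  assumes "\<And>i j. i \<notin> U \<Longrightarrow> B $ i $ j = 0"
  shows "id_on U ** B = B"
proof -
  have "(\<Sum>l\<in>UNIV. (if i = l \<and> i \<in> U then 1 else 0) * B $ l $ j) = B $ i $ j" for i j
  proof -
    have "(\<Sum>l\<in>UNIV. (if i = l \<and> i \<in> U then 1 else 0) * B $ l $ j)
        = (\<Sum>l\<in>UNIV. if l = i then B $ i $ j else 0)"
      by (rule sum.cong) (auto simp: assms)
    then show ?thesis by simp
  qed
  then show ?thesis by (simp add: matrix_matrix_mult_def id_on_def vec_eq_iff)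
qed

lemma inv_on_unique:
  assumes supp: "\<And>i j. i \<notin> U \<or> j \<notin> U \<Longrightarrow> B $ i $ j = 0"
    and AB: "A ** B = id_on U" and BA: "B ** A = id_on U"
  shows "inv_on U A = B"
  unfolding inv_on_def
proof (rule some_equality)
  show "(\<forall>i j. i \<notin> U \<or> j \<notin> U \<longrightarrow> B $ i $ j = 0) \<and> A ** B = id_on U \<and> B ** A = id_on U"
    using assms by blast
next
  fix C
  assume C: "(\<forall>i j. i \<notin> U \<or> j \<notin> U \<longrightarrow> C $ i $ j = 0) \<and> A ** C = id_on U \<and> C ** A = id_on U"
  have "C = C ** id_on U" using C by (simp add: id_on_right_neutral)
  also have "\<dots> = (C ** A) ** B" by (simp add: AB[symmetric] matrix_mul_assoc)
  also have "\<dots> = B" using C supp by (simp add: id_on_left_neutral)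
  finally show "C = B" .
qed

definition scheduled :: "('k \<Rightarrow> real) \<Rightarrow> 'k set" where
  "scheduled \<rho> = {k. \<rho> k = 1}"

(* The matrix [h_i], i in U, of size M x |U|. *)
definition channel_matrix ::
    "'k set \<Rightarrow> ('k \<Rightarrow> complex ^ 'm) \<Rightarrow> complex ^ 'k::finite ^ 'm::finite" where
  "channel_matrix U h = (\<chi> a i. if i \<in> U then h i $ a else 0)"

definition sqrt_power_diag :: "'k set \<Rightarrow> ('k \<Rightarrow> real) \<Rightarrow> complex ^ 'k::finite ^ 'k" where
  "sqrt_power_diag U \<alpha> = (\<chi> i j. if i = j \<and> i \<in> U then complex_of_real (sqrt (\<alpha> i)) else 0)"

definition zf_matrix ::
    "('k \<Rightarrow> real) \<Rightarrow> ('k \<Rightarrow> real) \<Rightarrow> ('k \<Rightarrow> complex ^ 'm) \<Rightarrow> complex ^ 'k::finite ^ 'm::finite" where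
  "zf_matrix \<rho> \<alpha> h =
     (let U = scheduled \<rho>; G = channel_matrix U h in
      sqrt (real CARD('m) - real (card U)) *\<^sub>R
        (G ** inv_on U (hermitian_transpose G ** G) ** sqrt_power_diag U \<alpha>))"

(* The column is zero for unscheduled users. *)
definition zf_precoder ::
    "('k \<Rightarrow> real) \<Rightarrow> ('k \<Rightarrow> real) \<Rightarrow> ('k \<Rightarrow> complex ^ 'm) \<Rightarrow> 'k::finite \<Rightarrow> complex ^ 'm::finite" where
  "zf_precoder \<rho> \<alpha> h i = column i (zf_matrix \<rho> \<alpha> h)"

definition transmitted ::
    "('k::finite \<Rightarrow> real) \<Rightarrow> ('k \<Rightarrow> complex ^ 'm::finite) \<Rightarrow> real \<Rightarrow> real \<Rightarrow> complex ^ 'm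
      \<Rightarrow> ('k \<Rightarrow> complex) \<Rightarrow> complex \<Rightarrow> complex ^ 'm" where
  "transmitted \<rho> t q \<rho>sen w s ssen =
     (\<Sum>i\<in>UNIV. \<rho> i *\<^sub>R (s i *s t i)) + sqrt (q * \<rho>sen) *\<^sub>R (ssen *s w)"

(* rho_i g^H t_i: this is A_i if g is the channel of user i itself, and B_{k,i} if g is the
   channel of another user k. *)
definition comm_gain ::
    "('k \<Rightarrow> real) \<Rightarrow> ('k \<Rightarrow> complex ^ 'm::finite) \<Rightarrow> complex ^ 'm \<Rightarrow> 'k \<Rightarrow> complex" where
  "comm_gain \<rho> t g i = complex_of_real (\<rho> i) * hinner g (t i)"

definition sens_gain ::
    "real \<Rightarrow> real \<Rightarrow> complex ^ 'm::finite \<Rightarrow> complex ^ 'm \<Rightarrow> complex" where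
  "sens_gain q \<rho>sen w g = complex_of_real (sqrt (q * \<rho>sen)) * hinner g w"

(* The gains are the coefficients of the symbols in the noiseless received signal g^H x. *)
lemma hinner_transmitted:
  fixes g w :: "complex ^ 'm::finite"
  shows "hinner g (transmitted \<rho> t q \<rho>sen w s ssen) =
     (\<Sum>i\<in>UNIV. comm_gain \<rho> t g i * s i) + sens_gain q \<rho>sen w g * ssen"
proof -
  have sc: "(r *\<^sub>R v) $ a = complex_of_real r * v $ a" for r and v :: "complex ^ 'm" and a
    unfolding vector_scaleR_component by (rule scaleR_conv_of_real)
  have "(\<Sum>a\<in>UNIV. cnj (g $ a) * (\<Sum>i\<in>UNIV. complex_of_real (\<rho> i) * (s i * t i $ a)))
      = (\<Sum>i\<in>UNIV. \<Sum>a\<in>UNIV. cnj (g $ a) * (complex_of_real (\<rho> i) * (s i * t i $ a)))"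
    by (subst sum.swap) (simp add: sum_distrib_left)
  then show ?thesis
    by (simp add: hinner_def transmitted_def comm_gain_def sens_gain_def sum.distrib
        sum_distrib_left sum_distrib_right algebra_simps sc del: vector_scaleR_component)
qed

(* t i and g k are the random precoding vectors and channels, sigma2 k the noise variances. *)
definition uatf_sinr ::
    "'a measure \<Rightarrow> ('k::finite \<Rightarrow> real) \<Rightarrow> ('k \<Rightarrow> 'a \<Rightarrow> complex ^ 'm::finite) \<Rightarrow> real \<Rightarrow> real
      \<Rightarrow> complex ^ 'm \<Rightarrow> ('k \<Rightarrow> 'a \<Rightarrow> complex ^ 'm) \<Rightarrow> ('k \<Rightarrow> real) \<Rightarrow> 'k \<Rightarrow> real" where
  "uatf_sinr P \<rho> t q \<rho>sen w g sigma2 k =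
     (let A = (\<lambda>\<omega>. comm_gain \<rho> (\<lambda>i. t i \<omega>) (g k \<omega>) k);
          B = (\<lambda>i \<omega>. comm_gain \<rho> (\<lambda>i. t i \<omega>) (g k \<omega>) i);
          C = (\<lambda>\<omega>. sens_gain q \<rho>sen w (g k \<omega>))
      in (cmod (\<integral>\<omega>. A \<omega> \<partial>P))\<^sup>2 /
         ((\<integral>\<omega>. (cmod (A \<omega>))\<^sup>2 \<partial>P) - (cmod (\<integral>\<omega>. A \<omega> \<partial>P))\<^sup>2
          + (\<Sum>i\<in>UNIV - {k}. \<integral>\<omega>. (cmod (B i \<omega>))\<^sup>2 \<partial>P)
          + (\<integral>\<omega>. (cmod (C \<omega>))\<^sup>2 \<partial>P) + sigma2 k))"

end

theory Submission
  imports Defs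
begin

text \<open>
  Write \<open>L\<close> for the number of scheduled users and let \<open>u\<^sub>i\<close> be the \<open>i\<close>-th column of
  \<open>G (G\<^sup>H G)\<^sup>-\<^sup>1\<close>.  The \<open>u\<^sub>i\<close> form the basis of the column space of \<open>G\<close> that is dual to the columns
  \<open>g\<^sub>i\<close>, so the channel estimates contribute a constant to the desired signal and no interference,
  and all fluctuations come from the estimation errors, which are independent of the precoder.
  What remains is \<open>E |u\<^sub>i|\<^sup>2 = 1 / (M - L)\<close>.  If \<open>y\<close> is the component of \<open>g\<^sub>i\<close> orthogonal to the other
  columns, then \<open>u\<^sub>i = y / |y|\<^sup>2\<close>.  Conditionally on the other columns, \<open>|y|\<^sup>2\<close> is the squared norm of a
  Gaussian vector in a space of complex dimension \<open>n = M - L + 1\<close>, so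
  \<open>E exp (- s |y|\<^sup>2) = (1 + s)\<^sup>-\<^sup>n\<close>, and integrating over \<open>s \<ge> 0\<close> gives \<open>E (1 / |y|\<^sup>2) = 1 / (n - 1)\<close>.
\<close>

section \<open>Gaussian integrals\<close>

text \<open>The factor sqrt (M - L) in the precoder turns E |u_i|^2 = 1 / (M - L) into E |t_i|^2 =
  \<alpha>_i. Since E |e_k^H t_i|^2 = \<epsilon>_k E |t_i|^2, each scheduled user i then adds
  \<epsilon>_k \<alpha>_i to the denominator of a scheduled user k, and the summand i = k is the
  variance of the desired signal. The conditioning is plain iterated integration: the joint law of
  the normalised channels is a product measure, and channel i is integrated first with the others
  frozen. The orthogonal complement is then a fixed real space of dimension 2 n, and |y|^2 is a sum
  of 2 n squared real coordinates, each contributing a factor (1 + s)^(-1/2). The assumption M > L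
  enters as n >= 2, the condition for 1 / |y|^2 to have a finite mean. The obstacle is singularity:
  for dependent channels the choice in \<open>inv_on\<close> is arbitrary, so the formulas for u_i
  hold only almost everywhere. Finiteness of E (1 / |y|^2) settles this too: it forces y to be
  nonzero almost surely, and an induction over the scheduled users makes their channels linearly
  independent almost surely.\<close>

lemma has_bochner_integral_lborel_prod:
  fixes f :: "'a::euclidean_space \<Rightarrow> real \<Rightarrow> 'c::{real_normed_field,banach,second_countable_topology}"
  assumes f: "\<And>b. b \<in> Basis \<Longrightarrow> has_bochner_integral lborel (f b) (c b)"
  shows "has_bochner_integral lborel (\<lambda>x. \<Prod>b\<in>Basis. f b (x \<bullet> b)) (\<Prod>b\<in>Basis. c b)"
proof -
  interpret product_sigma_finite "\<lambda>b::'a. lborel :: real measure" ..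
  have [measurable]: "f b \<in> borel_measurable borel" if "b \<in> Basis" for b
    using has_bochner_integral_iff f[OF that] by auto
  have meas: "(\<lambda>g. \<Sum>b\<in>Basis. g b *\<^sub>R b) \<in> Pi\<^sub>M Basis (\<lambda>b::'a. lborel :: real measure) \<rightarrow>\<^sub>M borel"
    by measurable
  have "integrable (Pi\<^sub>M Basis (\<lambda>b::'a. lborel)) (\<lambda>x. \<Prod>b\<in>Basis. f b (x b))"
    and "(\<integral>x. (\<Prod>b\<in>Basis. f b (x b)) \<partial>Pi\<^sub>M Basis (\<lambda>b::'a. lborel)) = (\<Prod>b\<in>Basis. c b)"
    using f by (auto intro!: product_integrable_prod prod.cong
        simp: product_integral_prod has_bochner_integral_iff)
  then show ?thesis
    using meas
    by (simp add: has_bochner_integral_iff lborel_def[where 'a='a] lborel_eq_real[symmetric] integrable_distr_eq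
        integral_distr)
qed

section \<open>Integrals against N(0, 1/2), the law of the real part of a CN(0, 1) variable\<close>

definition gauss_weight :: "real \<Rightarrow> real" where
  "gauss_weight x = exp (- x\<^sup>2) / sqrt pi"

lemma gauss_weight_measurable [measurable]: "gauss_weight \<in> borel_measurable borel"
  unfolding gauss_weight_def by measurable

lemma gauss_weight_nonneg [simp]: "0 \<le> gauss_weight x"
  by (simp add: gauss_weight_def)

lemma gauss_weight_eq_normal_density: "gauss_weight = normal_density 0 (1 / sqrt 2)"
  by (simp add: normal_density_def power_divide gauss_weight_def fun_eq_iff)

lemma has_bochner_integral_gauss_weight: "has_bochner_integral lborel gauss_weight 1"
  unfolding gauss_weight_eq_normal_density using normal_moment_even[of "1 / sqrt 2" 0 0] by simp

lemma has_bochner_integral_gauss_weight_1: "has_bochner_integral lborel (\<lambda>x. gauss_weight x * x) 0"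
  unfolding gauss_weight_eq_normal_density using normal_moment_odd[of "1 / sqrt 2" 0 0] by simp

lemma has_bochner_integral_gauss_weight_2: "has_bochner_integral lborel (\<lambda>x. gauss_weight x * x\<^sup>2) (1 / 2)"
  unfolding gauss_weight_eq_normal_density
  using normal_moment_even[of "1 / sqrt 2" 0 1] by (simp add: power_divide fact_numeral)

lemma has_bochner_integral_gauss_weight_exp:
  assumes "0 \<le> s"
  shows "has_bochner_integral lborel (\<lambda>x. gauss_weight x * exp (- s * x\<^sup>2)) (1 / sqrt (1 + s))"
proof -
  let ?\<sigma> = "1 / sqrt (2 * (1 + s))"
  \<comment> \<open>Multiplying by exp (- s x^2) turns the variance 1/2 into 1 / (2 (1 + s)); the
    quotient of the normalising constants is the value of the integral.\<close>
  have "gauss_weight x * exp (- s * x\<^sup>2) = normal_density 0 ?\<sigma> x * (1 / sqrt (1 + s))" for x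
  proof -
    have "- x\<^sup>2 + - s * x\<^sup>2 = - ((1 + s) * x\<^sup>2)" by (simp add: algebra_simps)
    moreover have "(1 / sqrt (2 * (1 + s)))\<^sup>2 = 1 / (2 * (1 + s))"
      using assms by (simp add: power_divide)
    moreover have "sqrt (2 * pi * (1 / (2 * (1 + s)))) = sqrt pi / sqrt (1 + s)"
      using assms by (simp add: real_sqrt_divide[symmetric] field_simps)
    ultimately show ?thesis
      using assms by (simp add: gauss_weight_def normal_density_def exp_add[symmetric])
  qed
  moreover have "has_bochner_integral lborel (\<lambda>x. normal_density 0 ?\<sigma> x) 1"
    using normal_moment_even[of ?\<sigma> 0 0] assms by simp
  ultimately show ?thesis
    using has_bochner_integral_mult_left[of "1 / sqrt (1 + s)" lborel "\<lambda>x. normal_density 0 ?\<sigma> x" 1]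
    by simp
qed

lemma has_bochner_integral_gauss_weight_iexp:
  "has_bochner_integral lborel (\<lambda>x. gauss_weight x *\<^sub>R iexp (\<theta> * x)) (exp (- \<theta>\<^sup>2 / 4))"
proof -
  have char: "has_bochner_integral lborel (\<lambda>x. std_normal_density x *\<^sub>R iexp (u * x)) (exp (- u\<^sup>2 / 2))" for u
  proof -
    interpret real_distribution std_normal_distribution by (rule real_dist_normal_dist)
    have "integrable std_normal_distribution (\<lambda>x. iexp (u * x))"
      by (rule integrable_iexp) auto
    then have "integrable lborel (\<lambda>x. std_normal_density x *\<^sub>R iexp (u * x))"
      by (subst (asm) integrable_density) auto
    moreover have "(\<integral>x. std_normal_density x *\<^sub>R iexp (u * x) \<partial>lborel) = exp (- u\<^sup>2 / 2)"
      using fun_cong[OF char_std_normal_distribution, of u] unfolding char_def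
      by (subst (asm) integral_density) (auto simp: exp_of_real)
    ultimately show ?thesis by (simp add: has_bochner_integral_iff)
  qed
  \<comment> \<open>The substitution x -> sqrt 2 x leads to the standard normal density; the outer
    factor sqrt 2 cancels the Jacobian.\<close>
  have *: "gauss_weight x *\<^sub>R iexp (\<theta> * x)
      = sqrt 2 *\<^sub>R (std_normal_density (sqrt 2 * x) *\<^sub>R iexp (\<theta> / sqrt 2 * (sqrt 2 * x)))" for x
    by (simp add: gauss_weight_def normal_density_def real_sqrt_mult power_mult_distrib)
  have "has_bochner_integral lborel
      (\<lambda>x. std_normal_density (sqrt 2 * x) *\<^sub>R iexp (\<theta> / sqrt 2 * (sqrt 2 * x)))
      (of_real (exp (- (\<theta> / sqrt 2)\<^sup>2 / 2)) /\<^sub>R \<bar>sqrt 2\<bar>)"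
    using iffD1[OF lborel_has_bochner_integral_real_affine_iff[of "sqrt 2" _ _ 0] char[of "\<theta> / sqrt 2"]]
    by (simp only: add_0 real_sqrt_eq_zero_cancel_iff zero_neq_numeral not_False_eq_True)
  from has_bochner_integral_scaleR_right[OF this, of "sqrt 2"]
  show ?thesis
    unfolding * by (simp only: scaleR_scaleR power_divide) simp
qed

section \<open>The complex Gaussian vector in real coordinates\<close>

lemma gaussian_density_prod:
  fixes z :: "complex ^ 'm::finite"
  shows "exp (- (norm z)\<^sup>2) / pi ^ CARD('m) = (\<Prod>b\<in>Basis. gauss_weight (z \<bullet> b))"
proof -
  have "(norm z)\<^sup>2 = (\<Sum>b\<in>Basis. (z \<bullet> b)\<^sup>2)"
    unfolding power2_norm_eq_inner by (subst euclidean_inner) (simp add: power2_eq_square)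
  moreover have "sqrt pi ^ DIM(complex ^ 'm) = pi ^ CARD('m)"
    by (simp add: power_mult power_mult_distrib mult.commute[of _ 2])
  ultimately show ?thesis
    by (simp add: gauss_weight_def prod_dividef exp_sum sum_negf[symmetric] del: DIM_cart)
qed

lemma sets_complex_gaussian [simp, measurable_cong]: "sets (complex_gaussian c) = sets borel"
  by (simp add: complex_gaussian_def)

lemma space_complex_gaussian [simp]: "space (complex_gaussian c) = UNIV"
  by (simp add: complex_gaussian_def)

lemma complex_gaussian_scale:
  assumes "0 \<le> c"
  shows "complex_gaussian c = distr (complex_gaussian 1) borel (\<lambda>z. sqrt c *\<^sub>R z)"
  unfolding complex_gaussian_def by (subst distr_distr) (auto simp: o_def)

text \<open>Independence of the real coordinates, in the form of a product rule for integrals.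
  Moments are obtained by setting \<open>f b\<close> to 1 on the coordinates that do not occur;
  values in a general field admit characteristic functions as well.\<close>

lemma has_bochner_integral_complex_gaussian_prod:
  fixes f :: "complex ^ 'm::finite \<Rightarrow> real \<Rightarrow> 'c::{real_normed_field,banach,second_countable_topology}"
  assumes [measurable]: "\<And>b. b \<in> Basis \<Longrightarrow> f b \<in> borel_measurable borel"
    and f: "\<And>b. b \<in> Basis \<Longrightarrow> has_bochner_integral lborel (\<lambda>x. gauss_weight x *\<^sub>R f b x) (c b)"
  shows "has_bochner_integral (complex_gaussian 1) (\<lambda>z. \<Prod>b\<in>Basis. f b (z \<bullet> b)) (\<Prod>b\<in>Basis. c b)"
proof -
  have "has_bochner_integral (lborel :: (complex ^ 'm) measure)
      (\<lambda>z. \<Prod>b\<in>Basis. gauss_weight (z \<bullet> b) *\<^sub>R f b (z \<bullet> b)) (\<Prod>b\<in>Basis. c b)"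
    by (rule has_bochner_integral_lborel_prod[OF f])
  then have "has_bochner_integral lborel
     (\<lambda>z. (exp (- (norm z)\<^sup>2) / pi ^ CARD('m)) *\<^sub>R (\<Prod>b\<in>Basis. f b (z \<bullet> b))) (\<Prod>b\<in>Basis. c b)"
    unfolding gaussian_density_prod
    by (simp add: scaleR_conv_of_real prod.distrib of_real_prod)
  then have "has_bochner_integral (density lborel (\<lambda>z. ennreal (exp (- (norm z)\<^sup>2) / pi ^ CARD('m))))
      (\<lambda>z. \<Prod>b\<in>Basis. f b (z \<bullet> b)) (\<Prod>b\<in>Basis. c b)"
    by (intro has_bochner_integral_density) auto
  then show ?thesis
    unfolding complex_gaussian_def
    by (intro has_bochner_integral_distr) (auto intro: has_bochner_integral_cong)
qed

lemma has_bochner_integral_complex_gaussian_iexp: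
  fixes v :: "complex ^ 'm::finite"
  shows "has_bochner_integral (complex_gaussian 1) (\<lambda>z. iexp (z \<bullet> v)) (exp (- (norm v)\<^sup>2 / 4))"
proof -
  have "has_bochner_integral (complex_gaussian 1) (\<lambda>z :: complex ^ 'm. \<Prod>b\<in>Basis. iexp ((v \<bullet> b) * (z \<bullet> b)))
       (\<Prod>b\<in>Basis. of_real (exp (- (v \<bullet> b)\<^sup>2 / 4)))"
    by (intro has_bochner_integral_complex_gaussian_prod has_bochner_integral_gauss_weight_iexp) measurable
  moreover have "(\<Prod>b\<in>Basis. iexp ((v \<bullet> b) * (z \<bullet> b))) = iexp (z \<bullet> v)" for z
    by (subst euclidean_inner[of z v]) (simp add: exp_sum[symmetric] sum_distrib_left mult.commute)
  moreover have "(\<Prod>b\<in>Basis. of_real (exp (- (v \<bullet> b)\<^sup>2 / 4))) = (of_real (exp (- (norm v)\<^sup>2 / 4)) :: complex)"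
    unfolding power2_norm_eq_inner
    by (subst euclidean_inner[of v v])
       (simp add: exp_sum[symmetric] of_real_prod[symmetric] sum_negf sum_divide_distrib power2_eq_square del: of_real_prod)
  ultimately show ?thesis by simp
qed

lemma has_bochner_integral_complex_gaussian_component:
  fixes b :: "complex ^ 'm::finite"
  assumes b: "b \<in> Basis"
  shows "has_bochner_integral (complex_gaussian 1) (\<lambda>z. z \<bullet> b) 0"
proof -
  have "has_bochner_integral (complex_gaussian 1) (\<lambda>z. \<Prod>d\<in>Basis. (if d = b then z \<bullet> d else 1))
      (\<Prod>d\<in>Basis. (if d = b then 0 else 1))"
    by (rule has_bochner_integral_complex_gaussian_prod[where f = "\<lambda>d x. if d = b then x else 1"])
       (auto intro: has_bochner_integral_gauss_weight has_bochner_integral_gauss_weight_1)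
  then show ?thesis using b by (simp add: prod.delta)
qed

lemma has_bochner_integral_complex_gaussian_component2:
  fixes b b' :: "complex ^ 'm::finite"
  assumes b: "b \<in> Basis" "b' \<in> Basis"
  shows "has_bochner_integral (complex_gaussian 1) (\<lambda>z. (z \<bullet> b) * (z \<bullet> b')) (if b = b' then 1 / 2 else 0)"
proof -
  \<comment> \<open>For \<open>b = b'\<close> the two conditionals multiply to x^2, so variances and
    covariances come from the same product rule.\<close>
  let ?f = "\<lambda>d (x::real). (if d = b then x else 1) * (if d = b' then x else 1)"
  let ?c = "\<lambda>d. if d = b then (if b = b' then 1 / 2 else 0) else if d = b' then 0 else (1::real)"
  have "has_bochner_integral (complex_gaussian 1) (\<lambda>z. \<Prod>d\<in>Basis. ?f d (z \<bullet> d)) (\<Prod>d\<in>Basis. ?c d)"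
    using has_bochner_integral_gauss_weight_2
    by (intro has_bochner_integral_complex_gaussian_prod)
       (auto intro: has_bochner_integral_gauss_weight has_bochner_integral_gauss_weight_1
          simp: power2_eq_square)
  moreover have "(\<Prod>d\<in>Basis. ?f d (z \<bullet> d)) = (z \<bullet> b) * (z \<bullet> b')" for z
    using b by (simp add: prod.distrib prod.delta)
  moreover have "(\<Prod>d\<in>Basis. ?c d) = (if b = b' then 1 / 2 else 0)"
  proof (cases "b = b'")
    case True
    then show ?thesis using b by (simp add: prod.delta cong: if_cong)
  next
    case False
    then show ?thesis using b by (auto intro!: prod_zero bexI[of _ b])
  qed
  ultimately show ?thesis by simp
qed

text \<open>The law of the auxiliary variables that linearise a quadratic exponent in
  \<open>integral_complex_gaussian_exp_orthonormal\<close>.\<close>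

definition real_gaussian :: "real measure" where
  "real_gaussian = density lborel gauss_weight"

lemma prob_space_real_gaussian: "prob_space real_gaussian"
  unfolding real_gaussian_def gauss_weight_eq_normal_density by (rule prob_space_normal_density) simp

lemma sets_real_gaussian [simp, measurable_cong]: "sets real_gaussian = sets borel"
  by (simp add: real_gaussian_def)

lemma has_bochner_integral_real_gaussian:
  fixes f :: "real \<Rightarrow> 'c::{banach,second_countable_topology}"
  assumes "f \<in> borel_measurable borel" "has_bochner_integral lborel (\<lambda>x. gauss_weight x *\<^sub>R f x) I"
  shows "has_bochner_integral real_gaussian f I"
  unfolding real_gaussian_def using assms by (intro has_bochner_integral_density) auto

lemma norm_orthonormal_sum:
  fixes B :: "'a::real_inner set"
  assumes "finite B" "pairwise orthogonal B" "\<And>b. b \<in> B \<Longrightarrow> norm b = 1"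
  shows "(norm (\<Sum>b\<in>B. y b *\<^sub>R b))\<^sup>2 = (\<Sum>b\<in>B. (y b)\<^sup>2)"
proof -
  have "(norm (\<Sum>b\<in>B. y b *\<^sub>R b))\<^sup>2 = (\<Sum>b\<in>B. (norm (y b *\<^sub>R b))\<^sup>2)"
    using assms by (intro norm_sum_Pythagorean) (auto simp: pairwise_def orthogonal_def)
  then show ?thesis using assms by simp
qed

(* Each factor exp (- s x^2) is the expectation of iexp (2 (sqrt s) x Y) for a Gaussian Y.  After
   exchanging the expectations only the orthonormality of B is used, so no rotation invariance of
   the Gaussian measure is needed. *)
lemma integral_complex_gaussian_exp_orthonormal:
  fixes B :: "(complex ^ 'm::finite) set"
  assumes fin: "finite B" and orth: "pairwise orthogonal B" and norm1: "\<And>b. b \<in> B \<Longrightarrow> norm b = 1"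
    and s: "0 \<le> s"
  shows "(\<integral>z. exp (- s * (\<Sum>b\<in>B. (z \<bullet> b)\<^sup>2)) \<partial>complex_gaussian 1) = (1 / sqrt (1 + s)) ^ card B"
proof -
  let ?\<gamma> = "complex_gaussian 1 :: (complex ^ 'm) measure"
  let ?Y = "\<Pi>\<^sub>M b\<in>B. real_gaussian"
  interpret R: prob_space real_gaussian by (rule prob_space_real_gaussian)
  interpret product_prob_space "\<lambda>b::complex ^ 'm. real_gaussian" B ..
  interpret G: prob_space ?\<gamma> by (rule prob_space_complex_gaussian)
  interpret Y: prob_space ?Y by (rule prob_space_PiM) (rule prob_space_real_gaussian)
  interpret GY: pair_prob_space ?\<gamma> ?Y ..
  \<comment> \<open>The coefficient comes from E exp (i \<theta> Y) = exp (- \<theta>^2 / 4): the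
    frequency \<theta> = 2 (sqrt s) x yields exp (- s x^2).\<close>
  let ?v = "\<lambda>y. \<Sum>b\<in>B. (2 * sqrt s * y b) *\<^sub>R b"
  have inner: "iexp (z \<bullet> ?v y) = (\<Prod>b\<in>B. iexp (2 * sqrt s * (z \<bullet> b) * y b))" for z y
    by (simp add: inner_sum_right exp_sum[OF fin, symmetric] sum_distrib_left mult.commute mult.left_commute)
  have Yint: "(\<integral>y. iexp (z \<bullet> ?v y) \<partial>?Y) = of_real (exp (- s * (\<Sum>b\<in>B. (z \<bullet> b)\<^sup>2)))" for z
  proof -
    have *: "has_bochner_integral real_gaussian (\<lambda>x. iexp (2 * sqrt s * (z \<bullet> b) * x))
        (exp (- (2 * sqrt s * (z \<bullet> b))\<^sup>2 / 4))" for b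
      by (intro has_bochner_integral_real_gaussian has_bochner_integral_gauss_weight_iexp) measurable
    have "(\<integral>y. iexp (z \<bullet> ?v y) \<partial>?Y) = (\<Prod>b\<in>B. of_real (exp (- (2 * sqrt s * (z \<bullet> b))\<^sup>2 / 4)))"
      unfolding inner using * by (subst product_integral_prod[OF fin]) (auto simp: has_bochner_integral_iff)
    also have "\<dots> = of_real (exp (- s * (\<Sum>b\<in>B. (z \<bullet> b)\<^sup>2)))"
      using s by (simp add: of_real_prod[symmetric] exp_sum[OF fin, symmetric] power_mult_distrib
         sum_negf sum_distrib_left del: of_real_prod)
    finally show ?thesis .
  qed
  \<comment> \<open>By Pythagoras the squared norm of \<open>?v y\<close> is a sum over B, so the
    expectation over z factors into functions of the single coordinates of y.\<close>
  have Zint: "(\<integral>z. iexp (z \<bullet> ?v y) \<partial>?\<gamma>) = of_real (\<Prod>b\<in>B. exp (- s * (y b)\<^sup>2))" for y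
  proof -
    have "(norm (?v y))\<^sup>2 = 4 * s * (\<Sum>b\<in>B. (y b)\<^sup>2)"
      using s by (simp add: norm_orthonormal_sum[OF fin orth norm1] power_mult_distrib sum_distrib_left)
    then show ?thesis
      using has_bochner_integral_complex_gaussian_iexp[of "?v y"]
      by (simp add: has_bochner_integral_iff exp_sum[OF fin, symmetric] sum_negf sum_distrib_left[symmetric])
  qed
  have "of_real (\<integral>z. exp (- s * (\<Sum>b\<in>B. (z \<bullet> b)\<^sup>2)) \<partial>?\<gamma>) = (\<integral>z. (\<integral>y. iexp (z \<bullet> ?v y) \<partial>?Y) \<partial>?\<gamma>)"
    unfolding Yint by simp
  also have "\<dots> = (\<integral>y. (\<integral>z. iexp (z \<bullet> ?v y) \<partial>?\<gamma>) \<partial>?Y)"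
  proof (rule GY.Fubini_integral[symmetric])
    show "integrable (?\<gamma> \<Otimes>\<^sub>M ?Y) (\<lambda>(z, y). iexp (z \<bullet> ?v y))"
      by (rule GY.integrable_const_bound[where B = 1]) auto
  qed
  also have "\<dots> = of_real (\<integral>y. (\<Prod>b\<in>B. exp (- s * (y b)\<^sup>2)) \<partial>?Y)"
    by (simp only: Zint integral_complex_of_real)
  also have "(\<integral>y. (\<Prod>b\<in>B. exp (- s * (y b)\<^sup>2)) \<partial>?Y) = (\<Prod>b\<in>B. 1 / sqrt (1 + s))"
  proof -
    have "has_bochner_integral real_gaussian (\<lambda>x. exp (- s * x\<^sup>2)) (1 / sqrt (1 + s))"
      using s by (intro has_bochner_integral_real_gaussian)
        (auto intro: has_bochner_integral_gauss_weight_exp[simplified])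
    then show ?thesis
      by (subst product_integral_prod[OF fin]) (auto simp: has_bochner_integral_iff)
  qed
  finally show ?thesis
    by (simp only: of_real_eq_iff prod_constant)
qed

section \<open>Inverse moments from the Laplace transform\<close>

lemma ennreal_top_eq_nat_bound:
  assumes "\<And>n::nat. ennreal (real n) \<le> x"
  shows "x = \<top>"
proof (rule ccontr)
  assume "x \<noteq> \<top>"
  then obtain n :: nat where "x < of_nat n"
    using ennreal_Ex_less_of_nat[of x] by (auto simp: top.not_eq_extremum)
  then show False using assms[of n] by (simp add: ennreal_of_nat_eq_real_of_nat)
qed

text \<open>At x = 0 both sides are infinite. Including this case lets the identity be integrated
  without excluding a null set, and lets a finite integral of the inverse certify that x is nonzero
  almost everywhere.\<close>

lemma inverse_ennreal_eq_nn_integral_exp: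
  assumes "0 \<le> x"
  shows "inverse (ennreal x) = (\<integral>\<^sup>+s. ennreal (exp (- s * x)) * indicator {0..} s \<partial>lborel)"
proof (cases "x = 0")
  case True
  have "ennreal (real n) \<le> emeasure lborel {0::real..}" for n
    using emeasure_mono[of "{0..real n}" "{0..}" lborel] by simp
  then have "emeasure lborel {0::real..} = \<top>"
    by (rule ennreal_top_eq_nat_bound)
  then show ?thesis using True by simp
next
  case False
  then have x: "x > 0" using assms by simp
  have "(\<integral>\<^sup>+s. ennreal (exp (- s * x)) * indicator {0..} s \<partial>lborel) = 0 - (- exp (- 0 * x) / x)"
  proof (rule nn_integral_FTC_atLeast[where F = "\<lambda>s. - exp (- s * x) / x"])
    show "((\<lambda>s. - exp (- s * x) / x) \<longlongrightarrow> 0) at_top"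
      using x by real_asymp
  qed (use x in \<open>auto intro!: derivative_eq_intros\<close>)
  then show ?thesis using x by (simp add: inverse_ennreal inverse_eq_divide)
qed

text \<open>The bound \<open>n \<ge> 2\<close> is what makes the integral converge at infinity. For
  n = M - L + 1 it says exactly that M > L.\<close>

lemma nn_integral_one_plus_power:
  assumes "n \<ge> 2"
  shows "(\<integral>\<^sup>+s. ennreal (1 / (1 + s) ^ n) * indicator {0..} s \<partial>lborel) = ennreal (1 / (real n - 1))"
proof -
  obtain k where n: "n = Suc (Suc k)" using assms by (metis add_2_eq_Suc le_Suc_ex)
  have "(\<integral>\<^sup>+s. ennreal (1 / (1 + s) ^ n) * indicator {0..} s \<partial>lborel)
      = 0 - (- 1 / ((real n - 1) * (1 + 0) ^ Suc k))"
  proof (rule nn_integral_FTC_atLeast[where F = "\<lambda>s. - 1 / ((real n - 1) * (1 + s) ^ Suc k)"])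
    fix s :: real assume s: "0 \<le> s"
    have "((\<lambda>s. - (1 / (real n - 1)) * inverse ((1 + s) ^ Suc k)) has_real_derivative
        - (1 / (real n - 1)) * (- (inverse ((1 + s) ^ Suc k) * (real (Suc k) * (1 + s) ^ k) * inverse ((1 + s) ^ Suc k)))) (at s)"
      using s assms by (auto intro!: derivative_eq_intros simp del: power_Suc)
    moreover have "- (1 / (real n - 1)) * (- (inverse ((1 + s) ^ Suc k) * (real (Suc k) * (1 + s) ^ k) * inverse ((1 + s) ^ Suc k)))
        = 1 / (1 + s) ^ n"
    proof -
      have "inverse a * (c * b) * inverse a = c * (b / (a * a))" for a b c :: real
        by (simp add: divide_inverse)
      moreover have "(1 + s) ^ k / ((1 + s) ^ Suc k * (1 + s) ^ Suc k) = 1 / (1 + s) ^ n"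
        using s by (simp add: n divide_eq_eq)
      ultimately show ?thesis by (simp add: n del: power_Suc)
    qed
    ultimately show "((\<lambda>s. - 1 / ((real n - 1) * (1 + s) ^ Suc k)) has_real_derivative 1 / (1 + s) ^ n) (at s)"
      by (simp add: divide_inverse)
  next
    have "LIM s at_top. (real n - 1) * (1 + s) ^ Suc k :> at_top"
      unfolding n by (intro filterlim_tendsto_pos_mult_at_top[OF tendsto_const] filterlim_pow_at_top
           filterlim_tendsto_add_at_top[OF tendsto_const filterlim_ident]) auto
    then show "((\<lambda>s. - 1 / ((real n - 1) * (1 + s) ^ Suc k)) \<longlongrightarrow> 0) at_top"
      by (intro real_tendsto_divide_at_top[OF tendsto_const])
  qed auto
  then show ?thesis by (simp add: n)
qed

text \<open>B will be a real basis of a complex space of dimension n; its 2 n square roots (1 +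
  s)^(-1/2) pair up to the integer power (1 + s)^(-n).\<close>

lemma nn_integral_complex_gaussian_inverse_orthonormal:
  fixes B :: "(complex ^ 'm::finite) set"
  assumes fin: "finite B" and orth: "pairwise orthogonal B" and norm1: "\<And>b. b \<in> B \<Longrightarrow> norm b = 1"
    and card: "card B = 2 * n" and n: "n \<ge> 2"
  shows "(\<integral>\<^sup>+z. inverse (ennreal (\<Sum>b\<in>B. (z \<bullet> b)\<^sup>2)) \<partial>complex_gaussian 1) = ennreal (1 / (real n - 1))"
proof -
  let ?\<gamma> = "complex_gaussian 1 :: (complex ^ 'm) measure"
  let ?X = "\<lambda>z. \<Sum>b\<in>B. (z \<bullet> b)\<^sup>2"
  interpret G: prob_space ?\<gamma> by (rule prob_space_complex_gaussian)
  interpret GL: pair_sigma_finite lborel ?\<gamma> ..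
  have X0: "0 \<le> ?X z" for z by (simp add: sum_nonneg)
  have "(\<integral>\<^sup>+z. inverse (ennreal (?X z)) \<partial>?\<gamma>)
      = (\<integral>\<^sup>+z. (\<integral>\<^sup>+s. ennreal (exp (- s * ?X z)) * indicator {0..} s \<partial>lborel) \<partial>?\<gamma>)"
    by (intro nn_integral_cong inverse_ennreal_eq_nn_integral_exp X0)
  also have "\<dots> = (\<integral>\<^sup>+s. (\<integral>\<^sup>+z. ennreal (exp (- s * ?X z)) * indicator {0..} s \<partial>?\<gamma>) \<partial>lborel)"
    by (rule GL.Fubini') measurable
  also have "\<dots> = (\<integral>\<^sup>+s. ennreal (1 / (1 + s) ^ n) * indicator {0..} s \<partial>lborel)"
  proof (intro nn_integral_cong)
    fix s :: real
    show "(\<integral>\<^sup>+z. ennreal (exp (- s * ?X z)) * indicator {0..} s \<partial>?\<gamma>) = ennreal (1 / (1 + s) ^ n) * indicator {0..} s"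
    proof (cases "0 \<le> s")
      case True
      have "(\<integral>\<^sup>+z. ennreal (exp (- s * ?X z)) \<partial>?\<gamma>) = ennreal (\<integral>z. exp (- s * ?X z) \<partial>?\<gamma>)"
        by (intro nn_integral_eq_integral G.integrable_const_bound[where B = 1])
           (use True X0 in \<open>auto simp: mult_nonneg_nonneg\<close>)
      also have "(\<integral>z. exp (- s * ?X z) \<partial>?\<gamma>) = 1 / (1 + s) ^ n"
        using integral_complex_gaussian_exp_orthonormal[OF fin orth norm1 True] True
        by (simp add: card power_mult power_divide)
      finally show ?thesis using True by simp
    qed simp
  qed
  also have "\<dots> = ennreal (1 / (real n - 1))"
    by (rule nn_integral_one_plus_power[OF n])
  finally show ?thesis .
qed

section \<open>Dual bases and zero-forcing directions\<close>

lemma hinner_add_right: "hinner x (y + z) = hinner x y + hinner x z"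
  by (simp add: hinner_def distrib_left sum.distrib)

lemma hinner_add_left: "hinner (x + y) z = hinner x z + hinner y z"
  by (simp add: hinner_def distrib_right sum.distrib)

lemma hinner_zero_right [simp]: "hinner x 0 = 0"
  by (simp add: hinner_def)

lemma hinner_zero_left [simp]: "hinner 0 x = 0"
  by (simp add: hinner_def)

lemma hinner_smult_right: "hinner x (c *s y) = c * hinner x y"
  by (simp add: hinner_def sum_distrib_left mult_ac)

lemma hinner_smult_left: "hinner (c *s x) y = cnj c * hinner x y"
  by (simp add: hinner_def sum_distrib_left mult_ac)

lemma scaleR_vec_eq_smult:
  fixes x :: "complex ^ 'm"
  shows "r *\<^sub>R x = complex_of_real r *s x"
  by (simp add: vec_eq_iff scaleR_conv_of_real[symmetric])

lemma hinner_scaleR_right: "hinner x (r *\<^sub>R y) = of_real r * hinner x y"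
  by (simp add: scaleR_vec_eq_smult hinner_smult_right)

lemma hinner_scaleR_left: "hinner (r *\<^sub>R x) y = of_real r * hinner x y"
  by (simp add: scaleR_vec_eq_smult hinner_smult_left)

lemma hinner_sum_right: "hinner x (\<Sum>i\<in>A. f i) = (\<Sum>i\<in>A. hinner x (f i))"
  by (induction A rule: infinite_finite_induct) (auto simp: hinner_add_right)

lemma hinner_diff_right: "hinner x (y - z) = hinner x y - hinner x z"
  by (simp add: hinner_def right_diff_distrib sum_subtractf)

lemma hinner_commute: "hinner x y = cnj (hinner y x)"
  by (simp add: hinner_def mult.commute)

lemma Re_hinner: "Re (hinner x y) = x \<bullet> y"
  by (simp add: hinner_def inner_vec_def inner_complex_def)

lemma Im_hinner: "Im (hinner x y) = (\<i> *s x) \<bullet> y"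
  unfolding Re_hinner[symmetric] hinner_smult_left by simp

lemma hinner_self: "hinner x x = of_real ((norm x)\<^sup>2)"
proof -
  have "Im (hinner x x) = 0"
    using hinner_commute[of x x] by (metis complex_cnj_cancel_iff complex_eq_iff cnj.simps(2) neg_equal_zero)
  then show ?thesis
    by (simp add: complex_eq_iff Re_hinner power2_norm_eq_inner)
qed

(* The complex span as a real subspace, so that the real orthogonal complement is available. *)
definition cspan :: "'k set \<Rightarrow> ('k \<Rightarrow> complex ^ 'm::finite) \<Rightarrow> (complex ^ 'm) set" where
  "cspan U h = span (h ` U \<union> (\<lambda>j. \<i> *s h j) ` U)"

lemma subspace_cspan: "subspace (cspan U h)"
  by (simp add: cspan_def)

text \<open>Multiplication by i permutes the generators up to sign, since i (i h_j) = - h_j; so the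
  real span is a complex subspace.\<close>

lemma cspan_smult:
  assumes "x \<in> cspan U h"
  shows "c *s x \<in> cspan U h"
proof -
  have i: "\<i> *s x \<in> cspan U h"
    using assms unfolding cspan_def
  proof (induction rule: span_induct_alt)
    case base
    show ?case by (simp add: span_zero)
  next
    case (step r v y)
    have "\<i> *s v \<in> cspan U h"
    proof (cases "v \<in> h ` U")
      case True
      then show ?thesis unfolding cspan_def by (auto intro: span_base)
    next
      case False
      then obtain j where j: "j \<in> U" "v = \<i> *s h j" using step by auto
      then have "\<i> *s v = - h j" by (simp add: vec_eq_iff mult.assoc[symmetric])
      then show ?thesis unfolding cspan_def using j by (auto intro: span_base span_neg)
    qed
    moreover have "\<i> *s (r *\<^sub>R v + y) = r *\<^sub>R (\<i> *s v) + \<i> *s y"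
      by (simp add: scaleR_vec_eq_smult vector_space_over_itself.scale_right_distrib vec_eq_iff algebra_simps)
    ultimately show ?case
      using step unfolding cspan_def by (auto intro!: span_add span_scale)
  qed
  have "c *s x = Re c *\<^sub>R x + Im c *\<^sub>R (\<i> *s x)"
    unfolding scaleR_vec_eq_smult vector_smult_assoc vec.scale_left_distrib[symmetric]
    by (subst complex_eq[of c]) (simp add: mult.commute)
  then show ?thesis
    using i assms unfolding cspan_def by (auto intro!: span_add span_scale)
qed

lemma cspan_base: "j \<in> U \<Longrightarrow> h j \<in> cspan U h"
  unfolding cspan_def by (auto intro: span_base)

lemma cspan_cong: "(\<And>j. j \<in> U \<Longrightarrow> h j = h' j) \<Longrightarrow> cspan U h = cspan U h'"
  unfolding cspan_def by (metis (mono_tags, lifting) image_cong)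

lemma cspan_mono: "U \<subseteq> V \<Longrightarrow> cspan U h \<subseteq> cspan V h"
  unfolding cspan_def by (intro span_mono) auto

text \<open>Lets linear arguments use complex multiples of the \<open>h j\<close> rather than real
  multiples of the doubled generating set.\<close>

lemma cspan_induct [consumes 1, case_names zero add smult]:
  assumes "x \<in> cspan U h" "P 0" "\<And>c j y. j \<in> U \<Longrightarrow> P y \<Longrightarrow> P (c *s h j + y)"
  shows "P x"
  using assms(1) unfolding cspan_def
proof (induction rule: span_induct_alt)
  case base
  show ?case by fact
next
  case (step r v y)
  from step(1) obtain c j where "j \<in> U" "r *\<^sub>R v = c *s h j"
    unfolding scaleR_vec_eq_smult by (auto simp del: vector_smult_assoc) (metis vector_smult_assoc)
  then show ?case using assms(3) step by auto
qed

lemma hinner_cspan_eq_0: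
  assumes "x \<in> cspan U h" "\<And>j. j \<in> U \<Longrightarrow> hinner (h j) z = 0"
  shows "hinner x z = 0"
  using assms(1)
  by (induction rule: cspan_induct) (auto simp: hinner_add_left hinner_smult_left assms(2))

text \<open>Testing real orthogonality against x gives the real part of the Hermitian product,
  testing against i x gives the imaginary part, and the span contains both.\<close>

lemma orthogonal_cspan_hinner:
  assumes "\<And>x. x \<in> cspan U h \<Longrightarrow> orthogonal z x" "x \<in> cspan U h"
  shows "hinner x z = 0"
  using assms(1)[OF assms(2)] assms(1)[OF cspan_smult[OF assms(2), of \<i>]]
  by (simp add: complex_eq_iff Re_hinner Im_hinner orthogonal_def inner_commute)

text \<open>Membership in the span is what makes \<open>u\<close> unique on U: otherwise any vector
  orthogonal to all \<open>h j\<close> could be added. Existence forces the \<open>h j\<close> to be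
  linearly independent.\<close>

definition dual_basis :: "'k set \<Rightarrow> ('k \<Rightarrow> complex ^ 'm::finite) \<Rightarrow> ('k \<Rightarrow> complex ^ 'm) \<Rightarrow> bool" where
  "dual_basis U h u \<longleftrightarrow>
     (\<forall>i\<in>U. u i \<in> cspan U h \<and> (\<forall>j\<in>U. hinner (h j) (u i) = (if j = i then 1 else 0)))"

lemma dual_basis_expand:
  assumes "dual_basis U h u" "finite U" "x \<in> cspan U h"
  shows "x = (\<Sum>l\<in>U. hinner (u l) x *s h l)"
  using assms(3)
proof (induction rule: cspan_induct)
  case zero
  show ?case by simp
next
  case (add c j y)
  have "hinner (u l) (h j) = (if l = j then 1 else 0)" if "l \<in> U" for l
    using assms(1) that add(1) unfolding dual_basis_def by (subst hinner_commute) auto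
  then have "(\<Sum>l\<in>U. hinner (u l) (c *s h j + y) *s h l)
      = (\<Sum>l\<in>U. (if l = j then c *s h j else 0) + hinner (u l) y *s h l)"
    by (intro sum.cong) (auto simp: hinner_add_right hinner_smult_right vec.scale_left_distrib)
  also have "\<dots> = c *s h j + y"
    using add assms(2) by (simp add: sum.distrib)
  finally show ?case ..
qed

section \<open>Gram matrices and the zero-forcing directions\<close>

definition gram :: "'k set \<Rightarrow> ('k \<Rightarrow> complex ^ 'm::finite) \<Rightarrow> complex ^ 'k::finite ^ 'k" where
  "gram U h = hermitian_transpose (channel_matrix U h) ** channel_matrix U h"

lemma gram_nth: "gram U h $ i $ j = (if i \<in> U \<and> j \<in> U then hinner (h i) (h j) else 0)"
  by (auto simp: gram_def matrix_matrix_mult_def hermitian_transpose_def channel_matrix_def hinner_def)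

definition zf_direction :: "'k set \<Rightarrow> ('k \<Rightarrow> complex ^ 'm::finite) \<Rightarrow> 'k::finite \<Rightarrow> complex ^ 'm" where
  "zf_direction U h i = column i (channel_matrix U h ** inv_on U (gram U h))"

lemma sum_supported:
  fixes f :: "'k::finite \<Rightarrow> 'b::comm_monoid_add"
  assumes "\<And>l. l \<notin> U \<Longrightarrow> f l = 0"
  shows "(\<Sum>l\<in>UNIV. f l) = (\<Sum>l\<in>U. f l)"
  using assms by (intro sum.mono_neutral_right) auto

lemma column_channel_matrix_mult:
  "column i (channel_matrix U h ** B) = (\<Sum>l\<in>U. B $ l $ i *s h l)"
proof -
  have "(\<Sum>l\<in>UNIV. (if l \<in> U then h l $ a else 0) * B $ l $ i) = (\<Sum>l\<in>U. B $ l $ i * h l $ a)" for a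
    by (subst sum_supported[of U]) (auto intro!: sum.cong)
  then show ?thesis
    by (simp add: vec_eq_iff column_def matrix_matrix_mult_def channel_matrix_def)
qed

text \<open>The predicate from which \<open>inv_on\<close> chooses, named so that the existence of
  an inverse can be stated and decided separately from the choice.\<close>

definition is_inv_on :: "'k::finite set \<Rightarrow> complex ^ 'k ^ 'k \<Rightarrow> complex ^ 'k ^ 'k \<Rightarrow> bool" where
  "is_inv_on U A B \<longleftrightarrow> (\<forall>i j. i \<notin> U \<or> j \<notin> U \<longrightarrow> B $ i $ j = 0) \<and> A ** B = id_on U \<and> B ** A = id_on U"

lemma inv_on_eq: "is_inv_on U A B \<Longrightarrow> inv_on U A = B"
  unfolding is_inv_on_def by (blast intro: inv_on_unique)

text \<open>On U, entry (i, j) of the product is h_i^H applied to the expansion of u_j in the h_l,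
  hence h_i^H u_j. So the Gram matrices of a basis and of its dual basis are inverse to each
  other.\<close>

lemma dual_basis_is_inv_on:
  assumes d: "dual_basis U h u"
  shows "is_inv_on U (gram U h) (\<chi> i j. if i \<in> U \<and> j \<in> U then hinner (u i) (u j) else 0)" (is "is_inv_on U ?A ?B")
proof -
  have AB: "(?A ** ?B) $ i $ j = id_on U $ i $ j" for i j
  proof -
    have "(?A ** ?B) $ i $ j = (\<Sum>l\<in>U. ?A $ i $ l * ?B $ l $ j)"
      unfolding matrix_matrix_mult_def by (simp add: sum_supported[of U] gram_nth)
    also have "\<dots> = (if i \<in> U \<and> j \<in> U then hinner (h i) (\<Sum>l\<in>U. hinner (u l) (u j) *s h l) else 0)"
      by (auto simp: gram_nth hinner_sum_right hinner_smult_right mult.commute)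
    also have "\<dots> = (if i \<in> U \<and> j \<in> U then hinner (h i) (u j) else 0)"
      using dual_basis_expand[OF d] d unfolding dual_basis_def by simp
    also have "\<dots> = id_on U $ i $ j"
      using d by (auto simp: dual_basis_def id_on_def)
    finally show ?thesis .
  qed
  \<comment> \<open>Both matrices are Hermitian, so the reversed product is the conjugate transpose
    of the one already computed.\<close>
  have "(?B ** ?A) $ i $ j = cnj ((?A ** ?B) $ j $ i)" for i j
    unfolding matrix_matrix_mult_def
    by (auto intro!: sum.cong simp: gram_nth mult.commute hinner_commute[symmetric])
  then have "(?B ** ?A) $ i $ j = id_on U $ i $ j" for i j
    unfolding AB by (auto simp: id_on_def)
  with AB show ?thesis
    by (simp add: is_inv_on_def vec_eq_iff)
qed

text \<open>Column i of the inverse Gram matrix consists of the numbers u_l^H u_i, the coefficients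
  of u_i itself in the h_l. Any dual basis written down explicitly therefore gives the zero-forcing
  directions.\<close>

lemma zf_direction_dual_basis:
  assumes d: "dual_basis U h u" and i: "i \<in> U"
  shows "zf_direction U h i = u i"
proof -
  have "u i \<in> cspan U h" using d i by (simp add: dual_basis_def)
  then show ?thesis
    using i dual_basis_expand[OF d]
    by (simp add: zf_direction_def inv_on_eq[OF dual_basis_is_inv_on[OF d]] column_channel_matrix_mult)
qed

lemma dual_basis_zf_direction:
  assumes "is_inv_on U (gram U h) B"
  shows "dual_basis U h (zf_direction U h)"
proof -
  have dir: "zf_direction U h i = (\<Sum>l\<in>U. B $ l $ i *s h l)" for i
    by (simp add: zf_direction_def inv_on_eq[OF assms] column_channel_matrix_mult)
  have "hinner (h j) (zf_direction U h i) = (gram U h ** B) $ j $ i" if "j \<in> U" for i j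
    unfolding matrix_matrix_mult_def using that
    by (simp add: sum_supported[of U] gram_nth dir hinner_sum_right hinner_smult_right mult.commute)
  moreover have "zf_direction U h i \<in> cspan U h" for i
    unfolding dir using subspace_cspan by (blast intro: subspace_sum cspan_smult cspan_base)
  ultimately show ?thesis
    using assms by (auto simp: dual_basis_def is_inv_on_def id_on_def)
qed

section \<open>Inverting a U x U block inside the full matrix\<close>

lemma matrix_add_rdistrib: "(A + B) ** C = A ** C + B ** (C :: 'a::semiring_1 ^ 'k ^ 'n::finite)"
  by (simp add: matrix_matrix_mult_def vec_eq_iff distrib_right sum.distrib)

lemma matrix_sub_ldistrib: "A ** (B - C) = A ** B - A ** (C :: 'a::ring_1 ^ 'k ^ 'n::finite)"
  by (simp add: matrix_matrix_mult_def vec_eq_iff right_diff_distrib sum_subtractf)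

lemma matrix_sub_rdistrib: "(A - B) ** C = A ** C - B ** (C :: 'a::ring_1 ^ 'k ^ 'n::finite)"
  by (simp add: matrix_matrix_mult_def vec_eq_iff left_diff_distrib sum_subtractf)

lemma matrix_inv_mult:
  assumes "invertible A"
  shows "A ** matrix_inv A = mat 1 \<and> matrix_inv A ** A = mat 1"
  unfolding matrix_inv_def using assms unfolding invertible_def by (rule someI_ex)

text \<open>With C = 1 - \<open>id_on U\<close>, the matrix A + C is block diagonal with blocks A
  and the identity. So is its inverse, and subtracting C leaves the inverse of the block A. The
  relations A C = C A = 0 and C C = C express the block structure.\<close>

lemma is_inv_on_matrix_inv:
  fixes A :: "complex ^ 'k::finite ^ 'k"
  assumes supp: "\<And>i j. i \<notin> U \<or> j \<notin> U \<Longrightarrow> A $ i $ j = 0" and det: "det (A + (mat 1 - id_on U)) \<noteq> 0"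
  shows "is_inv_on U A (matrix_inv (A + (mat 1 - id_on U)) - (mat 1 - id_on U))"
proof -
  let ?C = "mat 1 - id_on U :: complex ^ 'k ^ 'k"
  let ?X = "matrix_inv (A + ?C)"
  have X: "(A + ?C) ** ?X = mat 1" "?X ** (A + ?C) = mat 1"
    using det matrix_inv_mult[of "A + ?C"] by (auto simp: invertible_det_nz)
  have id: "id_on U ** id_on U = (id_on U :: complex ^ 'k ^ 'k)"
    by (rule id_on_right_neutral) (simp add: id_on_def)
  have Aid: "A ** id_on U = A" "id_on U ** A = A"
    by (auto intro: id_on_right_neutral id_on_left_neutral supp)
  have C: "A ** ?C = 0" "?C ** A = 0" "?C ** ?C = ?C"
    by (simp_all add: matrix_sub_ldistrib matrix_sub_rdistrib Aid id)
  have CX: "?C ** ?X = ?C"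
    using arg_cong[OF X(1), of "\<lambda>Y. ?C ** Y"] by (simp add: matrix_mul_assoc matrix_add_ldistrib C)
  have XC: "?X ** ?C = ?C"
    using arg_cong[OF X(2), of "\<lambda>Y. Y ** ?C"] by (simp add: matrix_mul_assoc[symmetric] matrix_add_rdistrib C)
  have AX: "A ** ?X = id_on U"
    using X(1) unfolding matrix_add_rdistrib CX by (simp add: algebra_simps)
  have XA: "?X ** A = id_on U"
    using X(2) unfolding matrix_add_ldistrib XC by (simp add: algebra_simps)
  have "A ** (?X - ?C) = id_on U"
    unfolding matrix_sub_ldistrib[of A ?X] C AX by simp
  moreover have "(?X - ?C) ** A = id_on U"
    unfolding matrix_sub_rdistrib[of ?X ?C A] C XA by simp
  moreover have "(?X - ?C) $ i $ j = 0" if "i \<notin> U \<or> j \<notin> U" for i j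
  proof -
    \<comment> \<open>D is annihilated by C on both sides, hence fixed by \<open>id_on U\<close> on
      both sides, which forces its entries outside U x U to vanish.\<close>
    define D where "D = ?X - ?C"
    have "?C ** D = 0" "D ** ?C = 0"
      unfolding D_def matrix_sub_ldistrib[of _ ?X ?C] matrix_sub_rdistrib[of ?X ?C] CX XC C(3) by simp_all
    then have D: "D = id_on U ** D" "D = D ** id_on U"
      unfolding matrix_sub_ldistrib[of _ "mat 1"] matrix_sub_rdistrib[of "mat 1"] by simp_all
    show ?thesis
    proof (cases "i \<in> U")
      case False
      then have "id_on U $ i $ l = 0" for l by (simp add: id_on_def)
      then show ?thesis
        using arg_cong[OF D(1), of "\<lambda>Y. Y $ i $ j"] by (simp add: matrix_matrix_mult_def D_def)
    next
      case True
      then have "id_on U $ l $ j = 0" for l using that by (auto simp: id_on_def)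
      then show ?thesis
        using arg_cong[OF D(2), of "\<lambda>Y. Y $ i $ j"] by (simp add: matrix_matrix_mult_def D_def)
    qed
  qed
  ultimately show ?thesis by (simp add: is_inv_on_def)
qed

lemma is_inv_on_det_nonzero:
  fixes A :: "complex ^ 'k::finite ^ 'k"
  assumes supp: "\<And>i j. i \<notin> U \<or> j \<notin> U \<Longrightarrow> A $ i $ j = 0" and B: "is_inv_on U A B"
  shows "det (A + (mat 1 - id_on U)) \<noteq> 0"
proof -
  have B': "A ** B = id_on U" "\<And>i j. i \<notin> U \<or> j \<notin> U \<Longrightarrow> B $ i $ j = 0"
    using B by (auto simp: is_inv_on_def)
  let ?C = "mat 1 - id_on U :: complex ^ 'k ^ 'k"
  have id: "id_on U ** id_on U = (id_on U :: complex ^ 'k ^ 'k)"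
    by (rule id_on_right_neutral) (simp add: id_on_def)
  have "A ** id_on U = A" "id_on U ** B = B"
    using B' by (auto intro: id_on_right_neutral id_on_left_neutral supp)
  then have "(A + ?C) ** (B + ?C) = mat 1"
    by (simp add: matrix_add_ldistrib matrix_add_rdistrib matrix_sub_ldistrib matrix_sub_rdistrib B' id)
  then have "invertible (A + ?C)" by (metis invertible_right_inverse)
  then show ?thesis by (simp add: invertible_det_nz)
qed

(* Linear independence of the channels in U.  The summand 1 - id_on U completes the U x U Gram matrix
   to a matrix over the whole user type with the same determinant. *)
definition regular_channels :: "'k::finite set \<Rightarrow> ('k \<Rightarrow> complex ^ 'm::finite) \<Rightarrow> bool" where
  "regular_channels U h \<longleftrightarrow> det (gram U h + (mat 1 - id_on U)) \<noteq> 0"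

lemma gram_supported: "i \<notin> U \<or> j \<notin> U \<Longrightarrow> gram U h $ i $ j = 0"
  by (auto simp: gram_nth)

lemma regular_channels_inv:
  assumes "regular_channels U h"
  shows "is_inv_on U (gram U h) (matrix_inv (gram U h + (mat 1 - id_on U)) - (mat 1 - id_on U))"
  using assms unfolding regular_channels_def by (intro is_inv_on_matrix_inv gram_supported)

lemma regular_channels_iff_inv: "regular_channels U h \<longleftrightarrow> (\<exists>B. is_inv_on U (gram U h) B)"
proof
  assume "\<exists>B. is_inv_on U (gram U h) B"
  then obtain B where "is_inv_on U (gram U h) B" ..
  with gram_supported show "regular_channels U h"
    unfolding regular_channels_def by (rule is_inv_on_det_nonzero)
qed (use regular_channels_inv in blast)

lemma regular_channels_dual_basis:
  "regular_channels U h \<Longrightarrow> dual_basis U h (zf_direction U h)"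
  using dual_basis_zf_direction regular_channels_inv by blast

lemma dual_basis_regular_channels: "dual_basis U h u \<Longrightarrow> regular_channels U h"
  using dual_basis_is_inv_on regular_channels_iff_inv by blast

section \<open>Orthogonal complements and the addition of one channel\<close>

lemma biorthogonal_independent:
  fixes v w :: "'i \<Rightarrow> 'a::euclidean_space"
  assumes fin: "finite I" and vw: "\<And>i j. i \<in> I \<Longrightarrow> j \<in> I \<Longrightarrow> v i \<bullet> w j = (if i = j then 1 else 0)"
  shows "inj_on v I" "independent (v ` I)"
proof -
  show inj: "inj_on v I"
    by (rule inj_onI) (metis vw zero_neq_one)
  show "independent (v ` I)"
  proof (rule independent_if_scalars_zero)
    fix f x assume 0: "(\<Sum>x\<in>v ` I. f x *\<^sub>R x) = 0" and "x \<in> v ` I"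
    then obtain j where j: "j \<in> I" "x = v j" by auto
    have "0 = (\<Sum>i\<in>I. f (v i) *\<^sub>R v i) \<bullet> w j"
      using 0 by (simp add: sum.reindex[OF inj])
    also have "\<dots> = (\<Sum>i\<in>I. if i = j then f (v i) else 0)"
      unfolding inner_sum_left by (rule sum.cong) (use j vw in auto)
    finally show "f x = 0" using j fin by simp
  qed (use fin in simp)
qed

text \<open>The real vectors h_j, i h_j are biorthogonal to u_j, i u_j with respect to the real
  inner product, hence linearly independent over the reals.\<close>

lemma dim_cspan:
  fixes h :: "'k::finite \<Rightarrow> complex ^ 'm::finite"
  assumes d: "dual_basis U h u"
  shows "dim (cspan U h) = 2 * card U"
proof -
  define v where "v f = (\<lambda>(j, b). if b then \<i> *s f j else (f j :: complex ^ 'm))" for f :: "'k \<Rightarrow> complex ^ 'm"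
  have biorth: "v h p \<bullet> v u p' = (if p = p' then 1 else 0)"
    if "p \<in> U \<times> UNIV" "p' \<in> U \<times> UNIV" for p p'
  proof -
    obtain j b j' b' where p: "p = (j, b)" "p' = (j', b')" by (cases p, cases p')
    then have "hinner (h j) (u j') = (if j = j' then 1 else 0)"
      using that d by (simp add: dual_basis_def)
    then show ?thesis
      by (cases b; cases b')
         (auto simp: p v_def Re_hinner[symmetric] hinner_smult_left hinner_smult_right)
  qed
  have img: "h ` U \<union> (\<lambda>j. \<i> *s h j) ` U = v h ` (U \<times> UNIV)"
  proof -
    have "U \<times> (UNIV :: bool set) = (\<lambda>j. (j, False)) ` U \<union> (\<lambda>j. (j, True)) ` U"
      by auto
    then show ?thesis by (simp add: image_Un image_image v_def)
  qed
  note bi = biorthogonal_independent[of "U \<times> (UNIV :: bool set)" "v h" "v u", OF _ biorth]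
  have "dim (cspan U h) = card (v h ` (U \<times> (UNIV :: bool set)))"
    unfolding cspan_def img using bi(2) by (simp add: dim_eq_card_independent)
  also have "\<dots> = 2 * card U"
    using bi(1) by (simp add: card_image card_cartesian_product)
  finally show ?thesis .
qed

lemma DIM_complex_vec: "DIM(complex ^ 'm::finite) = 2 * CARD('m)"
  by simp

text \<open>Presents the component of z orthogonal to the other channels as a sum over B with
  coordinates \<open>z \<bullet> b\<close>, the form in which the Gaussian inverse moment is
  available.\<close>

lemma orthogonal_complement_cspan:
  fixes h :: "'k::finite \<Rightarrow> complex ^ 'm::finite"
  assumes d: "dual_basis U h u"
  shows "\<exists>B. finite B \<and> pairwise orthogonal B \<and> (\<forall>b\<in>B. norm b = 1)
    \<and> card B = 2 * (CARD('m) - card U)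
    \<and> (\<forall>b\<in>B. \<forall>x\<in>cspan U h. orthogonal b x)
    \<and> (\<forall>z. z - (\<Sum>b\<in>B. (z \<bullet> b) *\<^sub>R b) \<in> cspan U h)"
proof -
  let ?W = "cspan U h"
  let ?V = "{y. \<forall>x\<in>?W. orthogonal x y}"
  have W: "subspace ?W" by (rule subspace_cspan)
  have V: "subspace ?V"
    by (auto simp: subspace_def orthogonal_def inner_add_right)
  obtain B where B: "B \<subseteq> ?V" "pairwise orthogonal B" "\<And>b. b \<in> B \<Longrightarrow> norm b = 1"
    "independent B" "card B = dim ?V" "span B = ?V"
    using orthonormal_basis_subspace[OF V] by blast
  have fin: "finite B" using B(4) by (rule independent_imp_finite)
  have "dim {y \<in> UNIV. \<forall>x\<in>?W. orthogonal x y} + dim ?W = dim (UNIV :: (complex ^ 'm) set)"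
    by (rule dim_subspace_orthogonal_to_vectors[OF W]) auto
  then have card: "card B = 2 * (CARD('m) - card U)"
    using B(5) dim_cspan[OF d] DIM_complex_vec[where 'm = 'm] by (simp del: DIM_cart)
  have "z - (\<Sum>b\<in>B. (z \<bullet> b) *\<^sub>R b) \<in> ?W" for z
  proof -
    obtain y x where yx: "y \<in> span ?W" "\<And>w. w \<in> span ?W \<Longrightarrow> orthogonal x w" "z = y + x"
      using orthogonal_subspace_decomp_exists[of ?W z] by blast
    have y: "y \<in> ?W" using yx(1) W by (simp add: span_eq_iff[THEN iffD2])
    have "x \<in> span B" unfolding B(6) using yx(2) by (auto simp: orthogonal_commute intro: span_base)
    then have "x = (\<Sum>b\<in>B. (x \<bullet> b) *\<^sub>R b)"
      using B(2,3) fin orthonormal_basis_expand[of B x] by (simp add: inner_commute)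
    moreover have "z \<bullet> b = x \<bullet> b" if "b \<in> B" for b
      using that B(1) y yx(3) by (auto simp: inner_add_left orthogonal_def)
    ultimately have "x = (\<Sum>b\<in>B. (z \<bullet> b) *\<^sub>R b)" by simp
    then show ?thesis using y yx(3) by simp
  qed
  note proj = this
  have orth: "orthogonal b x" if "b \<in> B" "x \<in> ?W" for b x
    using that B(1) by (auto simp: orthogonal_def inner_commute)
  show ?thesis
    by (intro exI[of _ B] conjI ballI allI fin B(2) B(3) card orth proj)
qed

text \<open>A Gram-Schmidt step for dual bases. As z - y lies in the old span, z^H y = |y|^2, so y /
  |y|^2 is dual to z. Each old u_j is made orthogonal to z by subtracting a multiple of y, which
  does not change its products with the old channels.\<close>

lemma dual_basis_insert:
  fixes h :: "'k::finite \<Rightarrow> complex ^ 'm::finite"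
  assumes d: "dual_basis U h u" and i: "i \<notin> U"
    and orth: "\<And>x. x \<in> cspan U h \<Longrightarrow> orthogonal y x" and zy: "z - y \<in> cspan U h" and y: "y \<noteq> 0"
  shows "dual_basis (insert i U) (h(i := z))
    (\<lambda>j. if j = i then (1 / (norm y)\<^sup>2) *\<^sub>R y else u j - hinner z (u j) *s ((1 / (norm y)\<^sup>2) *\<^sub>R y))"
proof -
  let ?h = "h(i := z)" and ?y = "(1 / (norm y)\<^sup>2) *\<^sub>R y"
  have sub: "cspan U h \<subseteq> cspan (insert i U) ?h"
    using cspan_mono[of U "insert i U" ?h] cspan_cong[of U ?h h] i by (metis fun_upd_apply subset_insertI)
  have span: "subspace (cspan (insert i U) ?h)" by (rule subspace_cspan)
  have "z \<in> cspan (insert i U) ?h"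
    using cspan_base[of i "insert i U" ?h] by simp
  then have "z - (z - y) \<in> cspan (insert i U) ?h"
    using span zy sub by (blast intro: subspace_diff)
  then have yin: "?y \<in> cspan (insert i U) ?h"
    using span by (simp add: subspace_scale)
  have hy: "hinner (h j) y = 0" if "j \<in> U" for j
    using orth cspan_base[OF that] by (rule orthogonal_cspan_hinner)
  have "hinner (z - y) y = 0"
    using hinner_cspan_eq_0[OF zy] hy by blast
  then have "hinner z y = of_real ((norm y)\<^sup>2)"
    using hinner_add_left[of "z - y" y y] by (simp add: hinner_self)
  then have zy1: "hinner z ?y = 1"
    using y unfolding hinner_scaleR_right by simp
  show ?thesis
    unfolding dual_basis_def
  proof (intro ballI conjI)
    fix j assume "j \<in> insert i U"
    then show "(if j = i then ?y else u j - hinner z (u j) *s ?y) \<in> cspan (insert i U) ?h"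
      using yin d sub span unfolding dual_basis_def
      by (auto intro!: subspace_diff[OF span] cspan_smult[OF yin])
  next
    fix j l assume "j \<in> insert i U" "l \<in> insert i U"
    then show "hinner (?h l) (if j = i then ?y else u j - hinner z (u j) *s ?y) = (if l = j then 1 else 0)"
      using d i hy zy1 unfolding dual_basis_def
      by (auto simp: hinner_diff_right hinner_smult_right hinner_scaleR_right)
  qed
qed

text \<open>The order of quantifiers matters: B depends on the other channels only and is fixed
  before z, so the squared norm becomes an explicit function of a Gaussian z.\<close>

lemma zf_direction_insert:
  fixes h :: "'k::finite \<Rightarrow> complex ^ 'm::finite"
  assumes reg: "regular_channels U h" and i: "i \<notin> U"
  shows "\<exists>B. finite B \<and> pairwise orthogonal B \<and> (\<forall>b\<in>B. norm b = 1)
    \<and> card B = 2 * (CARD('m) - card U)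
    \<and> (\<forall>z. (\<Sum>b\<in>B. (z \<bullet> b)\<^sup>2) \<noteq> 0 \<longrightarrow> regular_channels (insert i U) (h(i := z)) \<and>
       (norm (zf_direction (insert i U) (h(i := z)) i))\<^sup>2 = 1 / (\<Sum>b\<in>B. (z \<bullet> b)\<^sup>2))"
proof -
  note d = regular_channels_dual_basis[OF reg]
  obtain B where B: "finite B" "pairwise orthogonal B" "\<forall>b\<in>B. norm b = 1"
    "card B = 2 * (CARD('m) - card U)"
    "\<forall>b\<in>B. \<forall>x\<in>cspan U h. orthogonal b x"
    "\<forall>z. z - (\<Sum>b\<in>B. (z \<bullet> b) *\<^sub>R b) \<in> cspan U h"
    using orthogonal_complement_cspan[OF d] by (elim exE conjE) (rule that)
  have "regular_channels (insert i U) (h(i := z)) \<and>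
       (norm (zf_direction (insert i U) (h(i := z)) i))\<^sup>2 = 1 / (\<Sum>b\<in>B. (z \<bullet> b)\<^sup>2)"
    if nz: "(\<Sum>b\<in>B. (z \<bullet> b)\<^sup>2) \<noteq> 0" for z
  proof -
    define y where "y = (\<Sum>b\<in>B. (z \<bullet> b) *\<^sub>R b)"
    have ny: "(norm y)\<^sup>2 = (\<Sum>b\<in>B. (z \<bullet> b)\<^sup>2)"
      unfolding y_def using B(1-3) by (simp add: norm_orthonormal_sum)
    then have "y \<noteq> 0" using nz by auto
    moreover have "orthogonal y x" if "x \<in> cspan U h" for x
      unfolding y_def orthogonal_def inner_sum_left
      using B(5) that by (auto simp: orthogonal_def)
    moreover have "z - y \<in> cspan U h"
      using B(6) by (simp add: y_def)
    ultimately have db: "dual_basis (insert i U) (h(i := z))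
      (\<lambda>j. if j = i then (1 / (norm y)\<^sup>2) *\<^sub>R y else
         zf_direction U h j - hinner z (zf_direction U h j) *s ((1 / (norm y)\<^sup>2) *\<^sub>R y))"
      by (intro dual_basis_insert[OF d i])
    have "zf_direction (insert i U) (h(i := z)) i = (1 / (norm y)\<^sup>2) *\<^sub>R y"
      using zf_direction_dual_basis[OF db, of i] by simp
    then have "(norm (zf_direction (insert i U) (h(i := z)) i))\<^sup>2 = 1 / (norm y)\<^sup>2"
      using \<open>y \<noteq> 0\<close> by (simp add: power2_eq_square)
    then show ?thesis
      using dual_basis_regular_channels[OF db] ny by simp
  qed
  with B(1-4) show ?thesis by blast
qed

lemma zf_precoder_eq:
  fixes h :: "'k::finite \<Rightarrow> complex ^ 'm::finite"
  shows "zf_precoder \<rho> \<alpha> h i = (if i \<in> scheduled \<rho> then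
    (sqrt (real CARD('m) - real (card (scheduled \<rho>))) * sqrt (\<alpha> i)) *\<^sub>R zf_direction (scheduled \<rho>) h i else 0)"
proof -
  have entry: "(A ** sqrt_power_diag U \<alpha>) $ a $ i = (if i \<in> U then sqrt (\<alpha> i) *\<^sub>R A $ a $ i else 0)"
    for A :: "complex ^ 'k ^ 'm" and U a
  proof -
    have "(A ** sqrt_power_diag U \<alpha>) $ a $ i
        = (\<Sum>l\<in>UNIV. A $ a $ l * (if l = i \<and> l \<in> U then complex_of_real (sqrt (\<alpha> l)) else 0))"
      by (simp add: matrix_matrix_mult_def sqrt_power_diag_def)
    also have "\<dots> = (\<Sum>l\<in>UNIV. if l = i then (if i \<in> U then A $ a $ i * complex_of_real (sqrt (\<alpha> i)) else 0) else 0)"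
      by (rule sum.cong) auto
    finally show ?thesis by (simp add: scaleR_conv_of_real)
  qed
  have "zf_precoder \<rho> \<alpha> h i $ a = (if i \<in> scheduled \<rho> then
    (sqrt (real CARD('m) - real (card (scheduled \<rho>))) * sqrt (\<alpha> i)) *\<^sub>R zf_direction (scheduled \<rho>) h i else 0) $ a" for a
    unfolding zf_precoder_def zf_matrix_def zf_direction_def gram_def Let_def column_def
      vector_scaleR_component vec_lambda_beta entry by auto
  then show ?thesis by (rule vec_eq_iff[THEN iffD2, rule_format])
qed

section \<open>Second moment of the zero-forcing directions\<close>

lemma borel_measurable_vec_nth [measurable (raw)]:
  fixes f :: "'b \<Rightarrow> complex ^ 'm::finite"
  assumes "f \<in> borel_measurable N"
  shows "(\<lambda>x. f x $ a) \<in> borel_measurable N"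
proof -
  have "(\<lambda>v :: complex ^ 'm. v $ a) \<in> borel_measurable borel"
    by (intro borel_measurable_continuous_onI continuous_intros)
  from measurable_compose[OF assms this] show ?thesis .
qed

lemma borel_measurable_vecI:
  fixes f :: "'b \<Rightarrow> complex ^ 'm::finite"
  assumes [measurable]: "\<And>a. (\<lambda>x. f x $ a) \<in> borel_measurable N"
  shows "f \<in> borel_measurable N"
  unfolding borel_measurable_euclidean_space[of f]
proof
  fix b :: "complex ^ 'm" assume "b \<in> Basis"
  then obtain a c where b: "b = axis a c" by (auto simp: Basis_vec_def)
  show "(\<lambda>x. f x \<bullet> b) \<in> borel_measurable N"
    unfolding b inner_axis by measurable
qed

lemma borel_measurable_hinner [measurable (raw)]:
  fixes f g :: "'b \<Rightarrow> complex ^ 'm::finite"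
  assumes [measurable]: "f \<in> borel_measurable N" "g \<in> borel_measurable N"
  shows "(\<lambda>x. hinner (f x) (g x)) \<in> borel_measurable N"
  by (rule borel_measurable_continuous_Pair[OF assms])
     (unfold hinner_def, intro continuous_intros)

lemma borel_measurable_det:
  fixes A :: "'b \<Rightarrow> complex ^ 'k ^ 'k::finite"
  assumes [measurable]: "\<And>i j. (\<lambda>x. A x $ i $ j) \<in> borel_measurable N"
  shows "(\<lambda>x. det (A x)) \<in> borel_measurable N"
  unfolding det_def by measurable

text \<open>Cramer's rule, applied to column i of the inverse. Entries become quotients of
  determinants, which reduces measurability of the inverse to that of polynomials.\<close>

lemma matrix_inv_nth:
  fixes A :: "complex ^ 'k ^ 'k::finite"
  assumes "det A \<noteq> 0"
  shows "matrix_inv A $ l $ i = det (\<chi> a b. if b = l then (if a = i then 1 else 0) else A $ a $ b) / det A"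
proof -
  have "A ** matrix_inv A = mat 1"
    using matrix_inv_mult[of A] assms by (simp add: invertible_det_nz)
  then have "A *v column i (matrix_inv A) = column i (mat 1)"
    by (simp add: matrix_vector_mult_def matrix_matrix_mult_def column_def vec_eq_iff)
  then have "column i (matrix_inv A) =
      (\<chi> k. det (\<chi> a b. if b = k then column i (mat 1) $ a else A $ a $ b) / det A)"
    using cramer[OF assms] by blast
  then have "column i (matrix_inv A) $ l =
      (\<chi> k. det (\<chi> a b. if b = k then column i (mat 1) $ a else A $ a $ b) / det A) $ l"
    by (rule arg_cong)
  then show ?thesis by (simp add: column_def mat_def cong: if_cong)
qed

(* For a singular Gram matrix inv_on chooses from an empty predicate, hence always returns the same
   matrix.  Therefore the precoder is measurable everywhere, not just up to a null set. *)
lemma inv_on_gram_nth: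
  "inv_on U (gram U h) $ l $ i =
    (if regular_channels U h
     then det (\<chi> a b. if b = l then (if a = i then 1 else 0) else (gram U h + (mat 1 - id_on U)) $ a $ b)
            / det (gram U h + (mat 1 - id_on U)) - (mat 1 - id_on U) $ l $ i
     else (SOME B. False) $ l $ i)"
proof (cases "regular_channels U h")
  case True
  then show ?thesis
    using inv_on_eq[OF regular_channels_inv[OF True]]
    by (simp add: regular_channels_def matrix_inv_nth)
next
  case False
  then have "(\<lambda>B. is_inv_on U (gram U h) B) = (\<lambda>B. False)"
    using regular_channels_iff_inv by blast
  then have "inv_on U (gram U h) = (SOME B. False)"
    unfolding inv_on_def is_inv_on_def by simp
  then show ?thesis using False by simp
qed

context
  fixes X :: "'k::finite \<Rightarrow> 'b \<Rightarrow> complex ^ 'm::finite" and N :: "'b measure"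
  assumes X [measurable]: "\<And>i. X i \<in> borel_measurable N"
begin

lemma borel_measurable_gram:
  "(\<lambda>x. (gram U (\<lambda>j. X j x) + (mat 1 - id_on U)) $ i $ j) \<in> borel_measurable N"
  by (simp add: gram_nth)

lemma pred_regular_channels [measurable]: "Measurable.pred N (\<lambda>x. regular_channels U (\<lambda>j. X j x))"
  unfolding regular_channels_def
  using borel_measurable_det[OF borel_measurable_gram, of U] by measurable

text \<open>The family \<open>X\<close> is arbitrary because three instances occur: coordinates of a
  product space, the random channels on the probability space, and the left coordinates of the
  family of channels and errors.\<close>

lemma borel_measurable_zf_direction [measurable]:
  "(\<lambda>x. zf_direction U (\<lambda>j. X j x) i) \<in> borel_measurable N"
proof (rule borel_measurable_vecI)
  fix a
  have [measurable]: "(\<lambda>x. inv_on U (gram U (\<lambda>j. X j x)) $ l $ i) \<in> borel_measurable N" for l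
    unfolding inv_on_gram_nth
  proof (rule measurable_If[OF borel_measurable_diff[OF borel_measurable_divide]])
    show "(\<lambda>x. det (gram U (\<lambda>j. X j x) + (mat 1 - id_on U))) \<in> borel_measurable N"
      by (intro borel_measurable_det borel_measurable_gram)
    show "(\<lambda>x. det (\<chi> a b. if b = l then if a = i then 1 else 0
        else (gram U (\<lambda>j. X j x) + (mat 1 - id_on U)) $ a $ b)) \<in> borel_measurable N"
    proof (rule borel_measurable_det)
      fix a b
      show "(\<lambda>x. (\<chi> a b. if b = l then if a = i then 1 else 0
        else (gram U (\<lambda>j. X j x) + (mat 1 - id_on U)) $ a $ b) $ a $ b) \<in> borel_measurable N"
        using borel_measurable_gram[of U a b] by (cases "b = l") auto
    qed
    show "{x \<in> space N. regular_channels U (\<lambda>j. X j x)} \<in> sets N" by measurable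
  qed auto
  show "(\<lambda>x. zf_direction U (\<lambda>j. X j x) i $ a) \<in> borel_measurable N"
    unfolding zf_direction_def column_channel_matrix_mult by simp
qed

end

section \<open>Integrating out one channel at a time\<close>

definition channel_measure :: "'k::finite set \<Rightarrow> ('k \<Rightarrow> complex ^ 'm::finite) measure" where
  "channel_measure I = Pi\<^sub>M I (\<lambda>_. complex_gaussian 1)"

lemma prob_space_channel_measure: "prob_space (channel_measure I)"
  unfolding channel_measure_def by (intro prob_space_PiM prob_space_complex_gaussian)

lemma borel_measurable_channel_measure:
  "(\<lambda>h. h i) \<in> borel_measurable (channel_measure UNIV)"
  unfolding channel_measure_def by measurable

text \<open>This takes the place of conditioning on the other channels: in the inner integral they
  are constants.\<close>

lemma nn_integral_channel_measure_split:
  fixes f :: "('k::finite \<Rightarrow> complex ^ 'm::finite) \<Rightarrow> ennreal"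
  assumes "f \<in> borel_measurable (channel_measure UNIV)"
  shows "(\<integral>\<^sup>+h. f h \<partial>channel_measure UNIV)
    = (\<integral>\<^sup>+h. (\<integral>\<^sup>+z. f (h(i := z)) \<partial>complex_gaussian 1) \<partial>channel_measure (UNIV - {i}))"
proof -
  interpret G: prob_space "complex_gaussian 1 :: (complex ^ 'm) measure"
    by (rule prob_space_complex_gaussian)
  interpret product_sigma_finite "\<lambda>_::'k. complex_gaussian 1 :: (complex ^ 'm) measure" ..
  have "insert i (UNIV - {i}) = UNIV" by auto
  then show ?thesis
    using product_nn_integral_insert[of "UNIV - {i}" i f] assms by (simp add: channel_measure_def)
qed

lemma regular_channels_cong:
  assumes "\<And>j. j \<in> U \<Longrightarrow> h j = h' j"
  shows "regular_channels U h \<longleftrightarrow> regular_channels U h'"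
proof -
  have "gram U h $ i $ j = gram U h' $ i $ j" for i j
    using assms by (simp add: gram_nth)
  then have "gram U h = gram U h'" by (simp add: vec_eq_iff)
  then show ?thesis by (simp add: regular_channels_def)
qed

lemma complex_gaussian_insert:
  fixes h :: "'k::finite \<Rightarrow> complex ^ 'm::finite"
  assumes reg: "regular_channels U h" and i: "i \<notin> U" and card: "Suc (card U) < CARD('m)"
  shows "AE z in complex_gaussian 1. regular_channels (insert i U) (h(i := z))"
    and "(\<integral>\<^sup>+z. ennreal ((norm (zf_direction (insert i U) (h(i := z)) i))\<^sup>2) \<partial>complex_gaussian 1)
      = ennreal (1 / (real CARD('m) - real (Suc (card U))))"
proof -
  obtain B :: "(complex ^ 'm) set" where B: "finite B" "pairwise orthogonal B" "\<forall>b\<in>B. norm b = 1"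
    "card B = 2 * (CARD('m) - card U)"
    and main: "\<forall>z. (\<Sum>b\<in>B. (z \<bullet> b)\<^sup>2) \<noteq> 0 \<longrightarrow> regular_channels (insert i U) (h(i := z)) \<and>
       (norm (zf_direction (insert i U) (h(i := z)) i))\<^sup>2 = 1 / (\<Sum>b\<in>B. (z \<bullet> b)\<^sup>2)"
    using zf_direction_insert[OF reg i] by (elim exE conjE) (rule that)
  let ?X = "\<lambda>z. \<Sum>b\<in>B. (z \<bullet> b)\<^sup>2"
  \<comment> \<open>Here i is not yet counted in U, so n = M - \<open>card U\<close>, which is at
    least 2 by \<open>card\<close>, and n - 1 = M - \<open>Suc (card U)\<close>.\<close>
  have int: "(\<integral>\<^sup>+z. inverse (ennreal (?X z)) \<partial>complex_gaussian 1) = ennreal (1 / (real CARD('m) - real (Suc (card U))))"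
    using nn_integral_complex_gaussian_inverse_orthonormal[OF B(1,2) _ B(4)] B(3) card
    by (simp add: of_nat_diff)
  \<comment> \<open>The inverse of 0 is infinite, so the finite integral just computed rules out
    \<open>?X z = 0\<close> almost everywhere.\<close>
  have "AE z in complex_gaussian 1. inverse (ennreal (?X z)) \<noteq> \<infinity>"
  proof (rule nn_integral_PInf_AE)
    show "(\<lambda>z. inverse (ennreal (?X z))) \<in> borel_measurable (complex_gaussian 1)"
      by measurable
  qed (use int in auto)
  then have ae: "AE z in complex_gaussian 1. ?X z \<noteq> 0"
    by (rule AE_mp) auto
  then show "AE z in complex_gaussian 1. regular_channels (insert i U) (h(i := z))"
    by (rule AE_mp) (use main in auto)
  have "(\<integral>\<^sup>+z. ennreal ((norm (zf_direction (insert i U) (h(i := z)) i))\<^sup>2) \<partial>complex_gaussian 1)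
     = (\<integral>\<^sup>+z. inverse (ennreal (?X z)) \<partial>complex_gaussian 1)"
  proof (rule nn_integral_cong_AE, use ae in eventually_elim)
    fix z assume z: "?X z \<noteq> 0"
    then have "0 < ?X z" by (simp add: sum_nonneg less_le)
    then show "ennreal ((norm (zf_direction (insert i U) (h(i := z)) i))\<^sup>2) = inverse (ennreal (?X z))"
      using main[rule_format, OF z] by (simp only: inverse_ennreal inverse_eq_divide)
  qed
  then show "(\<integral>\<^sup>+z. ennreal ((norm (zf_direction (insert i U) (h(i := z)) i))\<^sup>2) \<partial>complex_gaussian 1)
      = ennreal (1 / (real CARD('m) - real (Suc (card U))))"
    using int by simp
qed

lemma regular_channels_empty: "regular_channels {} h"
proof -
  have "dual_basis {} h (\<lambda>_. 0)" by (simp add: dual_basis_def)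
  then show ?thesis by (rule dual_basis_regular_channels)
qed

(* Comparing the inner integrals of the indicators for insert i U and for U avoids relating null
   sets of the full product measure to null sets of its marginals. *)
lemma AE_regular_channels:
  fixes U :: "'k::finite set"
  assumes "finite U" "card U < CARD('m::finite)"
  shows "AE h in (channel_measure UNIV :: ('k \<Rightarrow> complex ^ 'm) measure). regular_channels U h"
  using assms
proof (induction U rule: finite_induct)
  case empty
  show ?case by (simp add: regular_channels_empty)
next
  case (insert i U)
  let ?\<Gamma> = "channel_measure UNIV :: ('k \<Rightarrow> complex ^ 'm) measure"
  let ?I = "\<lambda>U h. indicator {h :: 'k \<Rightarrow> complex ^ 'm. \<not> regular_channels U h} h :: ennreal"
  have meas: "?I V \<in> borel_measurable ?\<Gamma>" for V
  proof -
    have [measurable]: "Measurable.pred ?\<Gamma> (\<lambda>h. regular_channels V h)"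
      by (rule pred_regular_channels) (rule borel_measurable_channel_measure)
    show ?thesis by measurable
  qed
  have ae_iff: "(AE h in ?\<Gamma>. regular_channels V h) \<longleftrightarrow> (\<integral>\<^sup>+h. ?I V h \<partial>?\<Gamma>) = 0" for V
    by (subst nn_integral_0_iff_AE[OF meas]) (simp add: indicator_def)
  have "(\<integral>\<^sup>+h. ?I (insert i U) h \<partial>?\<Gamma>) \<le> (\<integral>\<^sup>+h. ?I U h \<partial>?\<Gamma>)"
    unfolding nn_integral_channel_measure_split[OF meas, of _ i]
  proof (rule nn_integral_mono)
    fix h :: "'k \<Rightarrow> complex ^ 'm"
    show "(\<integral>\<^sup>+z. ?I (insert i U) (h(i := z)) \<partial>complex_gaussian 1) \<le> (\<integral>\<^sup>+z. ?I U (h(i := z)) \<partial>complex_gaussian 1)"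
    proof (rule nn_integral_mono_AE)
      show "AE z in complex_gaussian 1. ?I (insert i U) (h(i := z)) \<le> ?I U (h(i := z))"
      proof (cases "regular_channels U h")
        case True
        show ?thesis
          using complex_gaussian_insert(1)[OF True insert.hyps(2)] insert.prems insert.hyps
          by (auto simp: indicator_def elim!: AE_mp)
      next
        \<comment> \<open>If the channels in U are singular already, changing channel i outside U
          keeps them so, and the indicator on the right is constantly 1.\<close>
        case False
        then have "\<not> regular_channels U (h(i := z))" for z
          using False insert.hyps by (subst regular_channels_cong[of U _ h]) auto
        then show ?thesis by (simp add: indicator_def)
      qed
    qed
  qed
  then show ?case
    using insert.IH insert.prems insert.hyps unfolding ae_iff by simp
qed

lemma nn_integral_zf_direction:
  fixes U :: "'k::finite set"
  assumes i: "i \<in> U" and card: "card U < CARD('m::finite)"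
  shows "(\<integral>\<^sup>+h. ennreal ((norm (zf_direction U h i))\<^sup>2) \<partial>(channel_measure UNIV :: ('k \<Rightarrow> complex ^ 'm) measure))
    = ennreal (1 / (real CARD('m) - real (card U)))" (is "integral\<^sup>N ?\<Gamma> _ = ?c")
proof -
  let ?U = "U - {i}"
  have U: "insert i ?U = U" "i \<notin> ?U" "Suc (card ?U) = card U"
    using i card.remove[of U i] by auto
  have [measurable]: "(\<lambda>h. zf_direction U h i) \<in> borel_measurable ?\<Gamma>"
    "Measurable.pred ?\<Gamma> (\<lambda>h. regular_channels ?U h)"
    using borel_measurable_zf_direction[where X = "\<lambda>i h. h i" and N = ?\<Gamma>]
      pred_regular_channels[where X = "\<lambda>i h. h i" and N = ?\<Gamma>] borel_measurable_channel_measure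
    by blast+
  \<comment> \<open>On the null set where the remaining channels are singular the integrand is
    replaced by the expected answer. The inner integral then equals \<open>?c\<close> for every h,
    and null sets of the marginal never have to be discussed.\<close>
  let ?f = "\<lambda>h :: 'k \<Rightarrow> complex ^ 'm. if regular_channels ?U h then ennreal ((norm (zf_direction U h i))\<^sup>2) else ?c"
  have "(\<integral>\<^sup>+h. ennreal ((norm (zf_direction U h i))\<^sup>2) \<partial>?\<Gamma>) = (\<integral>\<^sup>+h. ?f h \<partial>?\<Gamma>)"
    using AE_regular_channels[of ?U, where 'm = 'm] U(3) card
    by (intro nn_integral_cong_AE) (auto elim!: AE_mp)
  also have "\<dots> = (\<integral>\<^sup>+h. (\<integral>\<^sup>+z. ?f (h(i := z)) \<partial>complex_gaussian 1) \<partial>channel_measure (UNIV - {i}))"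
    by (rule nn_integral_channel_measure_split[of ?f i]) measurable
  also have "\<dots> = (\<integral>\<^sup>+h. ?c \<partial>(channel_measure (UNIV - {i}) :: ('k \<Rightarrow> complex ^ 'm) measure))"
  proof (rule nn_integral_cong)
    fix h :: "'k \<Rightarrow> complex ^ 'm"
    have reg: "regular_channels ?U (h(i := z)) \<longleftrightarrow> regular_channels ?U h" for z
      by (rule regular_channels_cong) auto
    show "(\<integral>\<^sup>+z. ?f (h(i := z)) \<partial>complex_gaussian 1) = ?c"
    proof (cases "regular_channels ?U h")
      case True
      then show ?thesis
        using complex_gaussian_insert(2)[OF True U(2)] card unfolding reg U by simp
    next
      case False
      interpret prob_space "complex_gaussian 1 :: (complex ^ 'm) measure"
        by (rule prob_space_complex_gaussian)
      show ?thesis unfolding reg using False emeasure_space_1 by simp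
    qed
  qed
  also have "\<dots> = ?c"
  proof -
    interpret prob_space "channel_measure (UNIV - {i} :: 'k set) :: ('k \<Rightarrow> complex ^ 'm) measure"
      by (rule prob_space_channel_measure)
    show ?thesis using emeasure_space_1 by simp
  qed
  finally show ?thesis .
qed

section \<open>Independent Gaussian factors\<close>

lemma vec_nth_eq_Basis_inner:
  fixes z :: "complex ^ 'm::finite"
  shows "z $ a = of_real (z \<bullet> axis a 1) + \<i> * of_real (z \<bullet> axis a \<i>)"
  by (simp add: inner_axis complex_eq_iff)

lemma axis_complex_Basis:
  "axis a 1 \<in> (Basis :: (complex ^ 'm::finite) set)" "axis a \<i> \<in> (Basis :: (complex ^ 'm) set)"
  by (auto simp: Basis_vec_def Basis_complex_def)

lemma has_bochner_integral_complex_gaussian_scale: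
  fixes f :: "complex ^ 'm::finite \<Rightarrow> 'c::{banach,second_countable_topology}"
  assumes c: "0 \<le> c" and [measurable]: "f \<in> borel_measurable borel"
    and f: "has_bochner_integral (complex_gaussian 1) (\<lambda>z. f (sqrt c *\<^sub>R z)) I"
  shows "has_bochner_integral (complex_gaussian c) f I"
  unfolding complex_gaussian_scale[OF c] using f by (intro has_bochner_integral_distr) auto

lemma has_bochner_integral_complex_gaussian_nth:
  assumes c: "0 \<le> c"
  shows "has_bochner_integral (complex_gaussian c) (\<lambda>z :: complex ^ 'm::finite. z $ a) 0"
proof (rule has_bochner_integral_complex_gaussian_scale[OF c])
  have "has_bochner_integral (complex_gaussian 1) (\<lambda>z :: complex ^ 'm. z \<bullet> b) 0" if "b \<in> Basis" for b
    by (rule has_bochner_integral_complex_gaussian_component[OF that])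
  note * = has_bochner_integral_of_real[OF this, where 'a = complex]
  have "has_bochner_integral (complex_gaussian 1)
      (\<lambda>z :: complex ^ 'm. of_real (z \<bullet> axis a 1) + \<i> * of_real (z \<bullet> axis a \<i>)) (of_real 0 + \<i> * of_real 0)"
    by (intro has_bochner_integral_add has_bochner_integral_mult_right * axis_complex_Basis)
  then have "has_bochner_integral (complex_gaussian 1) (\<lambda>z :: complex ^ 'm. z $ a) 0"
    by (simp add: vec_nth_eq_Basis_inner[symmetric])
  from has_bochner_integral_scaleR_right[OF this, of "sqrt c"]
  show "has_bochner_integral (complex_gaussian 1) (\<lambda>z :: complex ^ 'm. (sqrt c *\<^sub>R z) $ a) 0"
    by simp
qed simp

lemma has_bochner_integral_complex_gaussian_nth2:
  assumes c: "0 \<le> c"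
  shows "has_bochner_integral (complex_gaussian c) (\<lambda>z :: complex ^ 'm::finite. cnj (z $ a) * z $ b)
    (if a = b then of_real c else 0)"
proof (rule has_bochner_integral_complex_gaussian_scale[OF c])
  let ?x = "\<lambda>(z :: complex ^ 'm) a. z \<bullet> axis a 1" and ?y = "\<lambda>(z :: complex ^ 'm) a. z \<bullet> axis a \<i>"
  have "has_bochner_integral (complex_gaussian 1) (\<lambda>z :: complex ^ 'm. (z \<bullet> b) * (z \<bullet> b')) (if b = b' then 1 / 2 else 0)"
    if "b \<in> Basis" "b' \<in> Basis" for b b'
    by (rule has_bochner_integral_complex_gaussian_component2[OF that])
  note * = has_bochner_integral_of_real[OF this, where 'a = complex]
  let ?d = "\<lambda>b b' :: complex ^ 'm. complex_of_real (if b = b' then 1 / 2 else 0)"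
  \<comment> \<open>The product cnj (x_a + i y_a) (x_b + i y_b) in real coordinates: for a = b the
    two squares contribute 1/2 each, and every mixed product has mean 0.\<close>
  have "has_bochner_integral (complex_gaussian 1)
      (\<lambda>z. (of_real (?x z a * ?x z b) + of_real (?y z a * ?y z b))
         + \<i> * (of_real (?x z a * ?y z b) - of_real (?y z a * ?x z b)))
      ((?d (axis a 1) (axis b 1) + ?d (axis a \<i>) (axis b \<i>))
         + \<i> * (?d (axis a 1) (axis b \<i>) - ?d (axis a \<i>) (axis b 1)))"
    by (intro has_bochner_integral_add has_bochner_integral_diff has_bochner_integral_mult_right * axis_complex_Basis)
  moreover have "(of_real (?x z a * ?x z b) + of_real (?y z a * ?y z b))
         + \<i> * (of_real (?x z a * ?y z b) - of_real (?y z a * ?x z b)) = cnj (z $ a) * z $ b" for z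
    by (subst (1 2) vec_nth_eq_Basis_inner) (simp add: algebra_simps)
  moreover have "?d (axis a 1) (axis b 1) + ?d (axis a \<i>) (axis b \<i>)
         + \<i> * (?d (axis a 1) (axis b \<i>) - ?d (axis a \<i>) (axis b 1)) = (if a = b then 1 else 0)"
    by (auto simp: axis_eq_axis)
  ultimately have "has_bochner_integral (complex_gaussian 1) (\<lambda>z :: complex ^ 'm. cnj (z $ a) * z $ b) (if a = b then 1 else 0)"
    by simp
  from has_bochner_integral_scaleR_right[OF this, of c]
  have "has_bochner_integral (complex_gaussian 1) (\<lambda>z :: complex ^ 'm. c *\<^sub>R (cnj (z $ a) * z $ b))
      (if a = b then of_real c else 0)"
    by (simp add: scaleR_conv_of_real if_distrib cong: if_cong)
  moreover have "c *\<^sub>R (cnj (z $ a) * z $ b) = cnj ((sqrt c *\<^sub>R z) $ a) * (sqrt c *\<^sub>R z) $ b" for z :: "complex ^ 'm"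
    using c by (simp add: scaleR_scaleR[symmetric] del: scaleR_scaleR) (simp add: mult.assoc[symmetric] real_sqrt_mult_self)
  ultimately show "has_bochner_integral (complex_gaussian 1)
      (\<lambda>z :: complex ^ 'm. cnj ((sqrt c *\<^sub>R z) $ a) * (sqrt c *\<^sub>R z) $ b) (if a = b then of_real c else 0)"
    by simp
next
  have "continuous_on UNIV (\<lambda>z :: complex ^ 'm. cnj (z $ a) * z $ b)"
    by (intro continuous_intros)
  then show "(\<lambda>z :: complex ^ 'm. cnj (z $ a) * z $ b) \<in> borel_measurable borel"
    by (rule borel_measurable_continuous_onI)
qed

lemma borel_measurable_cnj [measurable (raw)]:
  "f \<in> borel_measurable N \<Longrightarrow> (\<lambda>x. cnj (f x)) \<in> borel_measurable N"
  by (rule measurable_compose[OF _ borel_measurable_continuous_onI]) (auto intro: continuous_intros)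

lemma norm_vec_power2: "of_real ((norm x)\<^sup>2) = (\<Sum>a\<in>UNIV. x $ a * cnj (x $ a))"
  by (subst hinner_self[symmetric]) (simp add: hinner_def mult.commute)

section \<open>The product of a Gaussian vector with an independent square-integrable vector\<close>

context prob_space
begin

context
  fixes X T :: "'a \<Rightarrow> complex ^ 'm::finite" and c :: real
  assumes c: "0 \<le> c" and X: "distr M borel X = complex_gaussian c"
    and indep: "indep_var borel X borel T"
    and T2: "integrable M (\<lambda>\<omega>. (norm (T \<omega>))\<^sup>2)"
begin

lemma indep_gaussian_measurable [measurable]:
  "X \<in> borel_measurable M" "T \<in> borel_measurable M"
  using indep_var_rv1[OF indep] indep_var_rv2[OF indep] by auto

lemma has_bochner_integral_gaussian_compose:
  fixes f :: "complex ^ 'm \<Rightarrow> complex"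
  assumes "has_bochner_integral (complex_gaussian c) f I"
  shows "has_bochner_integral M (\<lambda>\<omega>. f (X \<omega>)) I"
proof -
  have "f \<in> borel_measurable borel"
    using assms by (auto simp: has_bochner_integral_iff dest: borel_measurable_integrable)
  with assms show ?thesis
    unfolding X[symmetric] by (simp add: has_bochner_integral_iff integrable_distr_eq integral_distr)
qed

lemma indep_gaussian_mult:
  fixes f g :: "complex ^ 'm \<Rightarrow> complex"
  assumes f: "has_bochner_integral (complex_gaussian c) f I"
    and [measurable]: "f \<in> borel_measurable borel" "g \<in> borel_measurable borel"
    and g: "integrable M (\<lambda>\<omega>. g (T \<omega>))"
  shows "has_bochner_integral M (\<lambda>\<omega>. f (X \<omega>) * g (T \<omega>)) (I * expectation (\<lambda>\<omega>. g (T \<omega>)))"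
proof -
  have "indep_var borel (\<lambda>\<omega>. f (X \<omega>)) borel (\<lambda>\<omega>. g (T \<omega>))"
    using indep_var_compose[OF indep, of f borel g borel] by (simp add: o_def)
  with g has_bochner_integral_gaussian_compose[OF f] show ?thesis
    by (simp add: has_bochner_integral_iff indep_var_integrable indep_var_lebesgue_integral)
qed

lemma integrable_square_nth: "integrable M (\<lambda>\<omega>. T \<omega> $ a)"
proof (rule Bochner_Integration.integrable_bound)
  show "integrable M (\<lambda>\<omega>. 1 + (norm (T \<omega>))\<^sup>2)" using T2 by simp
  have "norm (x $ a) \<le> 1 + (norm x)\<^sup>2" for x :: "complex ^ 'm"
  proof -
    have "0 \<le> (norm x - 1)\<^sup>2" by simp
    then have "2 * norm x \<le> 1 + (norm x)\<^sup>2" by (simp add: power2_diff)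
    then show ?thesis
      using Finite_Cartesian_Product.norm_nth_le[of x a] norm_ge_zero[of x] by linarith
  qed
  then show "AE \<omega> in M. norm (T \<omega> $ a) \<le> norm (1 + (norm (T \<omega>))\<^sup>2)"
    by (auto intro: order_trans)
qed measurable

lemma integrable_square_nth2: "integrable M (\<lambda>\<omega>. T \<omega> $ a * cnj (T \<omega> $ b))"
proof (rule Bochner_Integration.integrable_bound[OF T2])
  have "norm (x $ a * cnj (x $ b)) \<le> norm ((norm x)\<^sup>2)" for x :: "complex ^ 'm"
    by (simp add: norm_mult power2_eq_square mult_mono Finite_Cartesian_Product.norm_nth_le)
  then show "AE \<omega> in M. norm (T \<omega> $ a * cnj (T \<omega> $ b)) \<le> norm ((norm (T \<omega>))\<^sup>2)"
    by simp
qed measurable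

lemma has_bochner_integral_hinner_gaussian:
  "has_bochner_integral M (\<lambda>\<omega>. hinner (X \<omega>) (T \<omega>)) 0"
proof -
  have "has_bochner_integral (complex_gaussian c) (\<lambda>z :: complex ^ 'm. cnj (z $ a)) 0" for a
    using has_bochner_integral_cnj[OF has_bochner_integral_complex_gaussian_nth[OF c]] by simp
  then have "has_bochner_integral M (\<lambda>\<omega>. cnj (X \<omega> $ a) * T \<omega> $ a) (0 * expectation (\<lambda>\<omega>. T \<omega> $ a))" for a
    using integrable_square_nth
    by (intro indep_gaussian_mult[where f = "\<lambda>z. cnj (z $ a)" and g = "\<lambda>z. z $ a"])
       (auto intro!: borel_measurable_continuous_onI continuous_intros)
  then have "has_bochner_integral M (\<lambda>\<omega>. \<Sum>a\<in>UNIV. cnj (X \<omega> $ a) * T \<omega> $ a) (\<Sum>a\<in>(UNIV :: 'm set). 0)"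
    by (intro has_bochner_integral_sum) simp
  then show ?thesis by (simp add: hinner_def)
qed

text \<open>Expand |X^H T|^2 into a double sum over components. Independence separates X from T, the
  covariance c I of X removes the off-diagonal terms, and the diagonal ones add up to E
  |T|^2.\<close>

lemma has_bochner_integral_hinner_gaussian_square:
  "has_bochner_integral M (\<lambda>\<omega>. (cmod (hinner (X \<omega>) (T \<omega>)))\<^sup>2) (c * expectation (\<lambda>\<omega>. (norm (T \<omega>))\<^sup>2))"
proof -
  let ?E = "\<lambda>a b. expectation (\<lambda>\<omega>. T \<omega> $ a * cnj (T \<omega> $ b))"
  have "has_bochner_integral M (\<lambda>\<omega>. (cnj (X \<omega> $ a) * X \<omega> $ b) * (T \<omega> $ a * cnj (T \<omega> $ b)))
     ((if a = b then of_real c else 0) * ?E a b)" for a b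
    using integrable_square_nth2
    by (intro indep_gaussian_mult[where f = "\<lambda>z. cnj (z $ a) * z $ b" and g = "\<lambda>z. z $ a * cnj (z $ b)"]
          has_bochner_integral_complex_gaussian_nth2[OF c])
       (auto intro!: borel_measurable_continuous_onI continuous_intros)
  then have "has_bochner_integral M
     (\<lambda>\<omega>. \<Sum>a\<in>UNIV. \<Sum>b\<in>UNIV. (cnj (X \<omega> $ a) * X \<omega> $ b) * (T \<omega> $ a * cnj (T \<omega> $ b)))
     (\<Sum>a\<in>UNIV. \<Sum>b\<in>UNIV. (if a = b then of_real c else 0) * ?E a b)"
    by (intro has_bochner_integral_sum)
  moreover have "(\<Sum>a\<in>UNIV. \<Sum>b\<in>UNIV. (cnj (X \<omega> $ a) * X \<omega> $ b) * (T \<omega> $ a * cnj (T \<omega> $ b)))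
      = of_real ((cmod (hinner (X \<omega>) (T \<omega>)))\<^sup>2)" for \<omega>
    by (simp only: complex_norm_square) (simp add: hinner_def sum_product mult_ac)
  moreover have "(\<Sum>a\<in>UNIV. \<Sum>b\<in>UNIV. (if a = b then of_real c else 0) * ?E a b)
      = of_real (c * expectation (\<lambda>\<omega>. (norm (T \<omega>))\<^sup>2))"
  proof -
    have "(\<Sum>a\<in>UNIV. \<Sum>b\<in>UNIV. (if a = b then of_real c else 0) * ?E a b) = of_real c * (\<Sum>a\<in>UNIV. ?E a a)"
      by (simp add: mult_delta_left sum_distrib_left)
    also have "(\<Sum>a\<in>UNIV. ?E a a) = expectation (\<lambda>\<omega>. of_real ((norm (T \<omega>))\<^sup>2))"
      unfolding norm_vec_power2 by (rule Bochner_Integration.integral_sum[symmetric]) (rule integrable_square_nth2)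
    also have "expectation (\<lambda>\<omega>. complex_of_real ((norm (T \<omega>))\<^sup>2)) = of_real (expectation (\<lambda>\<omega>. (norm (T \<omega>))\<^sup>2))"
      by (rule integral_complex_of_real)
    finally show ?thesis by (simp only: of_real_mult)
  qed
  ultimately have "has_bochner_integral M (\<lambda>\<omega>. complex_of_real ((cmod (hinner (X \<omega>) (T \<omega>)))\<^sup>2))
      (of_real (c * expectation (\<lambda>\<omega>. (norm (T \<omega>))\<^sup>2)))"
    by simp
  then show ?thesis
    using has_bochner_integral_Re by fastforce
qed

end

end

text \<open>Disjoint blocks of an independent family are independent. With B the left summand this
  separates an error from the precoder; with B empty it makes a constant vector independent of any
  channel.\<close>

lemma (in prob_space) indep_var_family:
  fixes Z :: "'i \<Rightarrow> 'a \<Rightarrow> 'b::topological_space"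
  assumes indep: "indep_vars (\<lambda>_. borel) Z UNIV" and p: "p \<notin> B"
    and F: "F \<in> Pi\<^sub>M B (\<lambda>_. borel) \<rightarrow>\<^sub>M N"
  shows "indep_var borel (Z p) N (\<lambda>\<omega>. F (restrict (\<lambda>q. Z q \<omega>) B))"
proof -
  have "indep_var (Pi\<^sub>M {p} (\<lambda>_. borel)) (\<lambda>\<omega>. restrict (\<lambda>q. Z q \<omega>) {p})
     (Pi\<^sub>M B (\<lambda>_. borel)) (\<lambda>\<omega>. restrict (\<lambda>q. Z q \<omega>) B)"
    by (rule indep_var_restrict[OF indep]) (use p in auto)
  from indep_var_compose[OF this, of "\<lambda>f. f p" borel F N] F show ?thesis
    by (simp add: o_def)
qed

text \<open>The joint law of channels and errors is a product measure; its image under reindexing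
  along \<open>Inl\<close> is the product over the channels alone.\<close>

lemma (in prob_space) distr_indep_subfamily:
  fixes Y Z :: "'k::finite \<Rightarrow> 'a \<Rightarrow> complex ^ 'm::finite"
  assumes indep: "indep_vars (\<lambda>_. borel) (case_sum Y Z) (UNIV :: ('k + 'k) set)"
    and Y: "\<And>i. distr M borel (Y i) = complex_gaussian 1"
  shows "distr M (Pi\<^sub>M UNIV (\<lambda>_. borel)) (\<lambda>\<omega> i. Y i \<omega>) = channel_measure UNIV"
proof -
  let ?X = "case_sum Y Z"
  have rv: "?X p \<in> borel_measurable M" for p
    using indep by (auto simp: indep_vars_def)
  then have [measurable]: "Y i \<in> borel_measurable M" for i
    by (metis old.sum.simps(5))
  have ps: "prob_space (distr M borel (?X p))" for p
    by (rule prob_space_distr) (rule rv)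
  have "distr M (Pi\<^sub>M UNIV (\<lambda>_. borel)) (\<lambda>\<omega>. \<lambda>p\<in>UNIV. ?X p \<omega>) = Pi\<^sub>M UNIV (\<lambda>p. distr M borel (?X p))"
    using indep indep_vars_iff_distr_eq_PiM[where I = UNIV and M' = "\<lambda>_. borel" and X = ?X] rv by simp
  then have "distr (distr M (Pi\<^sub>M UNIV (\<lambda>_. borel)) (\<lambda>\<omega>. \<lambda>p\<in>UNIV. ?X p \<omega>)) (Pi\<^sub>M UNIV (\<lambda>i. distr M borel (?X (Inl i))))
      (\<lambda>f. \<lambda>i\<in>UNIV. f (Inl i)) = Pi\<^sub>M UNIV (\<lambda>i. distr M borel (?X (Inl i)))"
    using distr_PiM_reindex[of UNIV "\<lambda>p. distr M borel (?X p)" Inl UNIV] ps by simp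
  moreover have "distr (distr M (Pi\<^sub>M UNIV (\<lambda>_. borel)) (\<lambda>\<omega>. \<lambda>p\<in>UNIV. ?X p \<omega>)) (Pi\<^sub>M UNIV (\<lambda>i. distr M borel (?X (Inl i))))
      (\<lambda>f. \<lambda>i\<in>UNIV. f (Inl i)) = distr M (Pi\<^sub>M UNIV (\<lambda>_. borel)) (\<lambda>\<omega> i. Y i \<omega>)"
  proof -
    have s: "sets (Pi\<^sub>M UNIV (\<lambda>i. distr M borel (?X (Inl i)))) = sets (Pi\<^sub>M UNIV (\<lambda>_::'k. borel))"
      by (intro sets_PiM_cong) auto
    have "distr (distr M (Pi\<^sub>M UNIV (\<lambda>_. borel)) (\<lambda>\<omega>. \<lambda>p\<in>UNIV. ?X p \<omega>)) (Pi\<^sub>M UNIV (\<lambda>_::'k. borel))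
      (\<lambda>f. \<lambda>i\<in>UNIV. f (Inl i)) = distr M (Pi\<^sub>M UNIV (\<lambda>_. borel)) (\<lambda>\<omega> i. Y i \<omega>)"
      using rv by (subst distr_distr) (auto simp: o_def restrict_def intro!: measurable_PiM_single')
    then show ?thesis
      by (metis (no_types, lifting) distr_cong s)
  qed
  ultimately show ?thesis
    by (simp add: Y channel_measure_def)
qed

text \<open>The mixed term 2 a Re H integrates to 0 because H has mean 0. The representation of X is
  demanded only almost everywhere, which leaves room for the singular channels.\<close>

lemma (in prob_space) has_bochner_integral_add_const:
  fixes X H :: "'a \<Rightarrow> complex"
  assumes [measurable]: "X \<in> borel_measurable M"
    and X: "AE \<omega> in M. X \<omega> = of_real a + H \<omega>"
    and H: "has_bochner_integral M H 0" and H2: "has_bochner_integral M (\<lambda>\<omega>. (cmod (H \<omega>))\<^sup>2) v"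
  shows "has_bochner_integral M X (of_real a)"
    and "has_bochner_integral M (\<lambda>\<omega>. (cmod (X \<omega>))\<^sup>2) (a\<^sup>2 + v)"
proof -
  have [measurable]: "H \<in> borel_measurable M"
    using H by (auto simp: has_bochner_integral_iff)
  have const: "has_bochner_integral M (\<lambda>_. b) b" for b :: "'c::{banach,second_countable_topology}"
    by (simp add: has_bochner_integral_iff prob_space)
  have "has_bochner_integral M (\<lambda>\<omega>. of_real a + H \<omega>) (of_real a + 0)"
    by (intro has_bochner_integral_add const H)
  then show "has_bochner_integral M X (of_real a)"
    using X by (subst has_bochner_integral_cong_AE[where g = "\<lambda>\<omega>. of_real a + H \<omega>"]) auto
  have "(cmod (of_real a + H \<omega>))\<^sup>2 = a\<^sup>2 + (cmod (H \<omega>))\<^sup>2 + 2 * a * Re (H \<omega>)" for \<omega>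
    unfolding cmod_power2 by (simp add: power2_eq_square algebra_simps)
  moreover have "has_bochner_integral M (\<lambda>\<omega>. a\<^sup>2 + (cmod (H \<omega>))\<^sup>2 + 2 * a * Re (H \<omega>)) (a\<^sup>2 + v + 2 * a * Re 0)"
    by (intro has_bochner_integral_add has_bochner_integral_mult_right has_bochner_integral_Re const H H2)
  ultimately have "has_bochner_integral M (\<lambda>\<omega>. (cmod (of_real a + H \<omega>))\<^sup>2) (a\<^sup>2 + v)"
    by simp
  then show "has_bochner_integral M (\<lambda>\<omega>. (cmod (X \<omega>))\<^sup>2) (a\<^sup>2 + v)"
    using X by (subst has_bochner_integral_cong_AE[where g = "\<lambda>\<omega>. (cmod (of_real a + H \<omega>))\<^sup>2"]) (auto elim!: AE_mp)
qed

section \<open>The terms of the effective SINR\<close>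

theorem proposition2:
  fixes P :: "'a measure"
    and gbar e ghat g t :: "'k::finite \<Rightarrow> 'a \<Rightarrow> complex ^ 'm::finite"
    and \<rho> \<alpha> \<eta> \<epsilon> \<xi> \<sigma> :: "'k \<Rightarrow> real"
    and \<rho>sen q :: real
    and w :: "complex ^ 'm"
    and k :: 'k
  assumes "prob_space P"
    and indep: "prob_space.indep_vars P (\<lambda>_. borel) (case_sum gbar e) (UNIV :: ('k + 'k) set)"
    and gbar: "\<And>i. distr P borel (gbar i) = complex_gaussian 1"
    and e: "\<And>i. distr P borel (e i) = complex_gaussian (\<epsilon> i)"
    and ghat: "\<And>i \<omega>. ghat i \<omega> = sqrt (\<eta> i) *\<^sub>R gbar i \<omega>"
    and g: "\<And>i \<omega>. g i \<omega> = ghat i \<omega> + e i \<omega>"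
    and eta: "\<And>i. \<eta> i > 0"
    and epsilon: "\<And>i. \<epsilon> i \<ge> 0"
    and xi: "\<And>i. \<xi> i = \<eta> i + \<epsilon> i"
    and rho: "\<And>i. \<rho> i \<in> {0, 1}"
    and rhosen: "\<rho>sen \<in> {0, 1}"
    and alpha: "\<And>i. \<alpha> i \<ge> 0"
    and q: "q \<ge> 0"
    and w: "norm w = 1"
    and sigma: "\<And>i. (\<sigma> i)\<^sup>2 > 0"
    and antennas: "CARD('m) > card (scheduled \<rho>)"
    and zf: "\<And>i \<omega>. t i \<omega> = zf_precoder \<rho> \<alpha> (\<lambda>j. gbar j \<omega>) i"
  shows "uatf_sinr P \<rho> t q \<rho>sen w g (\<lambda>i. (\<sigma> i)\<^sup>2) k =
     (real CARD('m) - real (card (scheduled \<rho>))) * \<eta> k * \<rho> k * \<alpha> k /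
     (\<epsilon> k * (\<Sum>i\<in>UNIV. \<rho> i * \<alpha> i) + \<xi> k * \<rho>sen * q + (\<sigma> k)\<^sup>2)"
proof (cases "\<rho> k = 0")
  \<comment> \<open>Zero forcing does not suppress interference at an unscheduled user, so this case
    is treated apart: both numerators vanish and the quotients are 0.\<close>
  case True
  then show ?thesis by (simp add: uatf_sinr_def comm_gain_def)
next
  case False
  then have \<rho>k: "\<rho> k = 1" using rho[of k] by simp
  interpret prob_space P by fact
  define U where "U = scheduled \<rho>"
  define m where "m = real CARD('m) - real (card U)"
  have m: "0 < m" using antennas by (simp add: m_def U_def)
  have k: "k \<in> U" using \<rho>k by (simp add: U_def scheduled_def)
  have \<rho>: "\<rho> i = (if i \<in> U then 1 else 0)" for i
    using rho[of i] by (auto simp: U_def scheduled_def)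
  have rv: "case_sum gbar e p \<in> borel_measurable P" for p
    using indep by (auto simp: indep_vars_def)
  have [measurable]: "gbar i \<in> borel_measurable P" "e i \<in> borel_measurable P" for i
    using rv[of "Inl i"] rv[of "Inr i"] by auto
  let ?u = "\<lambda>i \<omega>. zf_direction U (\<lambda>j. gbar j \<omega>) i"
  have [measurable]: "?u i \<in> borel_measurable P" for i
    by (rule borel_measurable_zf_direction) measurable
  have t: "t i \<omega> = (if i \<in> U then (sqrt m * sqrt (\<alpha> i)) *\<^sub>R ?u i \<omega> else 0)" for i \<omega>
    by (simp add: zf zf_precoder_eq U_def m_def)
  have [measurable]: "t i \<in> borel_measurable P" for i
    unfolding t[abs_def] by measurable
  have [measurable]: "g i \<in> borel_measurable P" for i
    unfolding g[abs_def] ghat by measurable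
  have chan: "distr P (Pi\<^sub>M UNIV (\<lambda>_. borel)) (\<lambda>\<omega> i. gbar i \<omega>) = channel_measure UNIV"
    by (rule distr_indep_subfamily[OF indep gbar])
  have gmeas: "(\<lambda>\<omega> i. gbar i \<omega>) \<in> P \<rightarrow>\<^sub>M Pi\<^sub>M UNIV (\<lambda>_. borel)"
    by (rule measurable_PiM_single') auto
  have zmeas: "(\<lambda>h. zf_direction U h i) \<in> Pi\<^sub>M UNIV (\<lambda>_. borel) \<rightarrow>\<^sub>M (borel :: (complex ^ 'm) measure)" for i :: 'k
    by (rule borel_measurable_zf_direction[where X = "\<lambda>i h. h i"]) measurable
  have reg: "AE \<omega> in P. regular_channels U (\<lambda>j. gbar j \<omega>)"
    using AE_regular_channels[of U, where 'm = 'm] antennas unfolding chan[symmetric]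
    by (intro AE_distrD[OF gmeas]) (auto simp: U_def)
  have u2: "has_bochner_integral P (\<lambda>\<omega>. (norm (?u i \<omega>))\<^sup>2) (1 / m)" if "i \<in> U" for i
  proof (rule has_bochner_integral_nn_integral)
    have "(\<integral>\<^sup>+\<omega>. ennreal ((norm (?u i \<omega>))\<^sup>2) \<partial>P)
        = (\<integral>\<^sup>+h. ennreal ((norm (zf_direction U h i))\<^sup>2) \<partial>(channel_measure UNIV :: ('k \<Rightarrow> complex ^ 'm) measure))"
      unfolding chan[symmetric] using zmeas by (subst nn_integral_distr[OF gmeas]) auto
    also have "\<dots> = ennreal (1 / m)"
      using nn_integral_zf_direction[OF that, where 'm = 'm] antennas by (simp add: m_def U_def)
    finally show "(\<integral>\<^sup>+\<omega>. ennreal ((norm (?u i \<omega>))\<^sup>2) \<partial>P) = ennreal (1 / m)" .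
  qed (use m in auto)
  \<comment> \<open>The squared normalisation m = M - L of the precoder cancels the second moment 1
    / m of the direction.\<close>
  have t2: "has_bochner_integral P (\<lambda>\<omega>. (norm (t i \<omega>))\<^sup>2) (\<rho> i * \<alpha> i)" for i
  proof (cases "i \<in> U")
    case True
    from has_bochner_integral_mult_right[OF u2[OF True], of "m * \<alpha> i"]
    show ?thesis using True m alpha[of i] by (simp add: t \<rho> power_mult_distrib)
  next
    case False
    then show ?thesis by (simp add: t \<rho> has_bochner_integral_zero)
  qed
  have indep_t: "indep_var borel (e k) borel (t i)" for i
  proof -
    \<comment> \<open>The precoder written as a function of the left coordinates alone, among which
      \<open>Inr k\<close>, the index of \<open>e k\<close>, does not occur.\<close>
    let ?F = "\<lambda>f. (if i \<in> U then (sqrt m * sqrt (\<alpha> i)) *\<^sub>R zf_direction U (\<lambda>j. f (Inl j)) i else 0)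
       :: complex ^ 'm"
    have "?F \<in> Pi\<^sub>M (range Inl) (\<lambda>_. borel) \<rightarrow>\<^sub>M borel"
    proof -
      have "(\<lambda>f. zf_direction U (\<lambda>j. f (Inl j)) i) \<in> Pi\<^sub>M (range Inl) (\<lambda>_ :: 'k + 'k. borel :: (complex ^ 'm) measure) \<rightarrow>\<^sub>M borel"
        by (rule borel_measurable_zf_direction[where X = "\<lambda>j f. f (Inl j)"]) measurable
      then show ?thesis by measurable
    qed
    from indep_var_family[OF indep _ this, of "Inr k"] show ?thesis
      by (simp add: t[abs_def] image_iff cong: if_cong)
  qed
  let ?H = "\<lambda>i \<omega>. hinner (e k \<omega>) (t i \<omega>)"
  have H: "has_bochner_integral P (?H i) 0" for i
    using t2 by (intro has_bochner_integral_hinner_gaussian[OF epsilon e indep_t]) (auto simp: has_bochner_integral_iff)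
  have H2: "has_bochner_integral P (\<lambda>\<omega>. (cmod (?H i \<omega>))\<^sup>2) (\<epsilon> k * (\<rho> i * \<alpha> i))" for i
    using has_bochner_integral_hinner_gaussian_square[OF epsilon[of k] e indep_t, of i] t2[of i]
    by (simp add: has_bochner_integral_iff)
  let ?A = "\<lambda>i \<omega>. comm_gain \<rho> (\<lambda>i. t i \<omega>) (g k \<omega>) i"
  define a where "a = sqrt (\<eta> k) * (sqrt m * sqrt (\<alpha> k))"
  \<comment> \<open>Both k and i scheduled: duality reduces the contribution of the estimate to the
    constant \<open>a\<close> for i = k and to 0 otherwise. For i outside U everything vanishes, and
    i differs from k.\<close>
  have A: "AE \<omega> in P. ?A i \<omega> = of_real (if i = k then a else 0) + ?H i \<omega>" for i
    using reg
  proof eventually_elim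
    case (elim \<omega>)
    show ?case
    proof (cases "i \<in> U")
      case True
      then have "hinner (gbar k \<omega>) (?u i \<omega>) = (if k = i then 1 else 0)"
        using regular_channels_dual_basis[OF elim] k by (simp add: dual_basis_def)
      then show ?thesis
        using True by (auto simp: comm_gain_def \<rho> g ghat t a_def hinner_add_left hinner_scaleR_left
            hinner_scaleR_right algebra_simps)
    next
      case False
      then show ?thesis using k by (auto simp: comm_gain_def \<rho> t)
    qed
  qed
  have Ameas: "?A i \<in> borel_measurable P" for i
    unfolding comm_gain_def by measurable
  note A1 = has_bochner_integral_add_const(1)[OF Ameas A H H2]
    and A2 = has_bochner_integral_add_const(2)[OF Ameas A H H2]
  have a2: "a\<^sup>2 = m * \<eta> k * \<alpha> k"
    using m eta[of k] alpha[of k] by (simp add: a_def power_mult_distrib)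
  have EA: "expectation (?A k) = of_real a"
    using A1[of k] by (simp add: has_bochner_integral_iff)
  have EA2: "expectation (\<lambda>\<omega>. (cmod (?A i \<omega>))\<^sup>2) = (if i = k then a\<^sup>2 else 0) + \<epsilon> k * (\<rho> i * \<alpha> i)" for i
    using A2[of i] by (simp add: has_bochner_integral_iff)
  have EC: "expectation (\<lambda>\<omega>. (cmod (sens_gain q \<rho>sen w (g k \<omega>)))\<^sup>2) = \<xi> k * \<rho>sen * q"
  proof -
    let ?X = "\<lambda>\<omega>. hinner (gbar k \<omega>) w" and ?Y = "\<lambda>\<omega>. hinner (e k \<omega>) w"
    have const: "indep_var borel (case_sum gbar e p) borel (\<lambda>_. w)" for p
      using indep_var_family[OF indep, of p "{}" "\<lambda>_. w" borel] by simp
    have X2: "has_bochner_integral P (\<lambda>\<omega>. (cmod (?X \<omega>))\<^sup>2) 1"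
      using has_bochner_integral_hinner_gaussian_square[OF _ gbar const[of "Inl k", simplified]] w
      by (simp add: prob_space)
    have Y2: "has_bochner_integral P (\<lambda>\<omega>. (cmod (?Y \<omega>))\<^sup>2) (\<epsilon> k)"
      using has_bochner_integral_hinner_gaussian_square[OF epsilon e const[of "Inr k", simplified]] w
      by (simp add: prob_space)
    \<comment> \<open>The mixed term of the expanded square, written as e_k^H T with T a function of
      \<open>gbar k\<close> only, so the mean-zero lemma applies. Expanding the square replaces a
      proof that \<open>g k\<close> is Gaussian with variance \<xi>_k.\<close>
    have cross: "has_bochner_integral P (\<lambda>\<omega>. hinner (e k \<omega>) (cnj (?X \<omega>) *s w)) 0"
    proof (rule has_bochner_integral_hinner_gaussian[OF epsilon e])
      have "(\<lambda>f. cnj (hinner (f (Inl k)) w) *s w) \<in> Pi\<^sub>M (range Inl) (\<lambda>_ :: 'k + 'k. borel) \<rightarrow>\<^sub>M borel"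
        by (rule borel_measurable_vecI) (unfold vector_smult_component, measurable)
      from indep_var_family[OF indep _ this, of "Inr k"]
      show "indep_var borel (e k) borel (\<lambda>\<omega>. cnj (?X \<omega>) *s w)"
        by (simp add: image_iff)
      have "(norm (c *s w))\<^sup>2 = (cmod c)\<^sup>2" for c
      proof -
        have "hinner (c *s w) (c *s w) = (c * cnj c) * hinner w w"
          by (simp add: hinner_smult_left hinner_smult_right mult_ac)
        then show ?thesis
          unfolding hinner_self w complex_norm_square[symmetric]
          by (simp only: power_one of_real_1 mult_1_right of_real_eq_iff)
      qed
      then show "integrable P (\<lambda>\<omega>. (norm (cnj (?X \<omega>) *s w))\<^sup>2)"
        using X2 by (simp add: has_bochner_integral_iff)
    qed
    have "(cmod (sens_gain q \<rho>sen w (g k \<omega>)))\<^sup>2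
        = (q * \<rho>sen) * (\<eta> k * (cmod (?X \<omega>))\<^sup>2 + (cmod (?Y \<omega>))\<^sup>2
            + 2 * sqrt (\<eta> k) * Re (hinner (e k \<omega>) (cnj (?X \<omega>) *s w)))" for \<omega>
    proof -
      have "(cmod (of_real s * x + y))\<^sup>2 = s\<^sup>2 * (cmod x)\<^sup>2 + (cmod y)\<^sup>2 + 2 * s * Re (cnj x * y)" for s x y
        unfolding cmod_power2 by (simp add: power2_eq_square algebra_simps)
      then show ?thesis
        using q rhosen eta[of k]
        by (auto simp: sens_gain_def g ghat norm_mult power_mult_distrib hinner_add_left hinner_scaleR_left
            hinner_smult_right less_imp_le)
    qed
    moreover have "has_bochner_integral P (\<lambda>\<omega>. (q * \<rho>sen) * (\<eta> k * (cmod (?X \<omega>))\<^sup>2 + (cmod (?Y \<omega>))\<^sup>2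
            + 2 * sqrt (\<eta> k) * Re (hinner (e k \<omega>) (cnj (?X \<omega>) *s w))))
       ((q * \<rho>sen) * (\<eta> k * 1 + \<epsilon> k + 2 * sqrt (\<eta> k) * Re 0))"
      by (intro has_bochner_integral_add has_bochner_integral_mult_right has_bochner_integral_Re X2 Y2 cross)
    ultimately show ?thesis
      by (simp add: has_bochner_integral_iff xi mult_ac)
  qed
  \<comment> \<open>The variance of the desired signal supplies the summand i = k that the
    interference sum omits.\<close>
  have "\<epsilon> k * (\<rho> k * \<alpha> k) + (\<Sum>i\<in>UNIV - {k}. \<epsilon> k * (\<rho> i * \<alpha> i)) = \<epsilon> k * (\<Sum>i\<in>UNIV. \<rho> i * \<alpha> i)"
    by (subst sum.remove[of UNIV k "\<lambda>i. \<rho> i * \<alpha> i"]) (simp_all add: sum_distrib_left distrib_left)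
  moreover have "(\<Sum>i\<in>UNIV - {k}. expectation (\<lambda>\<omega>. (cmod (?A i \<omega>))\<^sup>2)) = (\<Sum>i\<in>UNIV - {k}. \<epsilon> k * (\<rho> i * \<alpha> i))"
    by (rule sum.cong) (auto simp: EA2)
  ultimately show ?thesis
    unfolding uatf_sinr_def Let_def EA EC EA2[of k]
    by (simp add: a2 \<rho>k m_def U_def algebra_simps)
qed

end
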